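(* Let $\mathcal{G}$ be a (non-degenerate) $[n,k,d]_q$ A$^s$MDS code whose dual $\mathcal{G}^\perp$ is an $[n,k^\perp,d^\perp]_q$ A$^t$MDS code, where $k^\perp=n-k$, $d>1$, and $s,t\ge 1$. Then: \begin{enumerate} \item (a) If $t>1$ then $n\le s(q+1)+k-1$. (b) If $s>1$ then $k\le t(q+1)-1$. \item If $t=1$ and $\mathcal{G}$ has a codeword of weight $d+s+1-\alpha$ for some integer $0\le \alpha\le s+1$, then $n\le q(s+1)+k-2+\alpha$. \item If $s=1$ then $n\le (t+1)(q+1)+k^\perp-2$, or equivalently $k\le (t+1)(q+1)-2$. \item If $s=t=1$, $q>3$ and $k\ge 3$, then $n\le 2q+k-2$, and if moreover $n>k+2$ then $k\le 2q-2$. \item If $t=1$ then $k+s-1\le m(k-1,q)$, equivalently $n\le m(k-1,q)+k^\perp-s+1$. \item If $s=1$ then $k^\perp+t-1\le m(k^\perp-1,q)$, so $n\le m(k^\perp-1,q)+k-t+1$. \item If $s=t=1$ then $k\le m(k-1,q)$ and $k^\perp\le m(k^\perp-1,q)$. \item $k\le (t+1)(q+1)-2$. \end{enumerate}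
   Context: A linear $[n,k,d]_q$ code is identified with a projective system: a finite multiset $\mathcal{G}$ of $n$ points (counted with multiplicity) of $\Sigma=\mathrm{PG}(k-1,q)$, not all lying in one hyperplane, such that $n-d=\max_H|\mathcal{G}\cap H|$ over all hyperplanes $H$ of $\Sigma$ (intersections counted with multiplicity). Equivalently, $\mathcal{G}$ is the multiset of columns of a $k\times n$ generator matrix of a non-degenerate linear code $C\subseteq\mathbb{F}_q^n$ of dimension $k$ and minimum distance $d$; a nonzero codeword has weight $n-|\mathcal{G}\cap H|$ for the corresponding hyperplane $H$. The Singleton defect is $S(\mathcal{G})=n-k+1-d$; $\mathcal{G}$ is an A$^s$MDS code if $S(\mathcal{G})=s$ (MDS if $s=0$). The dual code $\mathcal{G}^\perp$ is $C^\perp$, an $[n,n-k,d^\perp]_q$ code; $d^\perp$ equals the minimum size of a subfamily $Q\subseteq\mathcal{G}$ whose points (as vectors) span a vector space of dimension $|Q|-1$. $m(k,q)$ denotes the maximum length $n$ of a non-degenerate $[n,k,n-k+1]_q$ MDS code. *)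

theory Defs
  imports
    Complex_Main
    "HOL-Library.Function_Algebras"
    "HOL-Library.Cardinality"
    "HOL-Library.Extended_Nat"
begin

text \<open>
  Words of length \<open>n\<close> over a field are functions on \<open>nat\<close> that vanish
  outside \<open>{..<n}\<close>. The length has to be a term, since \<open>max_mds_length\<close> below
  ranges over codes of all lengths.
\<close>

definition word_scale :: "'a::field \<Rightarrow> (nat \<Rightarrow> 'a) \<Rightarrow> (nat \<Rightarrow> 'a)"
  where "word_scale c x = (\<lambda>i. c * x i)"

interpretation words: vector_space word_scale
  by unfold_locales (auto simp: word_scale_def fun_eq_iff algebra_simps)

definition word_space :: "nat \<Rightarrow> (nat \<Rightarrow> 'a::field) set"
  where "word_space n = {x. \<forall>i\<ge>n. x i = 0}"

definition hamming_dist :: "(nat \<Rightarrow> 'a::field) \<Rightarrow> (nat \<Rightarrow> 'a) \<Rightarrow> nat"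
  where "hamming_dist x y = card {i. x i \<noteq> y i}"

definition hamming_weight :: "(nat \<Rightarrow> 'a::field) \<Rightarrow> nat"
  where "hamming_weight x = card {i. x i \<noteq> 0}"

definition min_distance :: "(nat \<Rightarrow> 'a::field) set \<Rightarrow> nat"
  where "min_distance C = Min {hamming_dist x y | x y. x \<in> C \<and> y \<in> C \<and> x \<noteq> y}"

text \<open>
  The condition \<open>1 \<le> k\<close> is what makes the minimum distance meaningful: the zero
  code has no two distinct codewords.
\<close>

definition linear_code :: "nat \<Rightarrow> nat \<Rightarrow> nat \<Rightarrow> (nat \<Rightarrow> 'a::field) set \<Rightarrow> bool"
  where "linear_code n k d C \<longleftrightarrow>
    C \<subseteq> word_space n \<and> words.subspace C \<and> words.dim C = k \<and> 1 \<le> k \<and> min_distance C = d"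

text \<open>
  No coordinate vanishes on all of \<open>C\<close>; equivalently, every column of a generator
  matrix of \<open>C\<close> is nonzero and thus a point of the projective space.
\<close>

definition nondegenerate :: "nat \<Rightarrow> (nat \<Rightarrow> 'a::field) set \<Rightarrow> bool"
  where "nondegenerate n C \<longleftrightarrow> (\<forall>i<n. \<exists>x\<in>C. x i \<noteq> 0)"

definition dual_code :: "nat \<Rightarrow> (nat \<Rightarrow> 'a::field) set \<Rightarrow> (nat \<Rightarrow> 'a) set"
  where "dual_code n C = {y \<in> word_space n. \<forall>x\<in>C. (\<Sum>i<n. x i * y i) = 0}"

definition singleton_defect :: "nat \<Rightarrow> nat \<Rightarrow> nat \<Rightarrow> int"
  where "singleton_defect n k d = int n - int k + 1 - int d"

definition almost_mds :: "nat \<Rightarrow> nat \<Rightarrow> nat \<Rightarrow> nat \<Rightarrow> (nat \<Rightarrow> 'a::field) set \<Rightarrow> bool"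
  where "almost_mds s n k d C \<longleftrightarrow> linear_code n k d C \<and> singleton_defect n k d = int s"

text \<open>
  The number \<open>m(k,q)\<close>, where the field \<open>'a\<close> with \<open>q\<close> elements is passed as a type
  argument. It is extended-natural valued because the repetition codes are MDS
  of every length, so that \<open>m(1,q) = \<infinity>\<close>.
\<close>

definition max_mds_length :: "'a::{field,finite} itself \<Rightarrow> nat \<Rightarrow> enat"
  where "max_mds_length _ k =
    Sup {enat n | n. \<exists>(C :: (nat \<Rightarrow> 'a) set) d. almost_mds 0 n k d C \<and> nondegenerate n C}"

end

theory Submission
  imports Defs "HOL-Library.FuncSet"
begin

text \<open>
  Codes over a field with \<open>q\<close> elements are handled through cardinalities: a code of dimension
  \<open>k\<close> has \<open>q ^ k\<close> words, prescribing zeros in \<open>j\<close> positions leaves at least \<open>q ^ (k - j)\<close> of them,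
  and exactly that many if every nonzero dual word has weight greater than \<open>j\<close>.

  For words \<open>c\<close>, \<open>c'\<close> spanning a two-dimensional subcode that vanishes on \<open>Z\<close>, every position
  outside \<open>Z\<close> is a zero of at least one of the \<open>q + 1\<close> words \<open>c\<close>, \<open>c' + t c\<close>. Hence
  \<open>w(c) + q d \<le> q (n - |Z|)\<close>, and suitable choices of \<open>Z\<close> give the bounds (1), (2), (3) and (8).
  If \<open>d' = k\<close>, the restriction of the code to the zeros of a word of minimum weight is MDS of
  dimension \<open>k - 1\<close>, which gives (5), (6) and (7).

  For (4), prescribing \<open>k - 3\<close> zeros turns the columns into points of the projective plane, no four
  of them collinear, and one has to show that there are at most \<open>2 q + 1\<close> of them if \<open>q > 3\<close>.
  For \<open>2 q + 3\<close> points every secant has exactly three points. A product over the slopes seen from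
  the vertices of a triangle, as in Segre's lemma of tangents, shows that the points can be
  represented by vectors such that the three vectors of every secant sum to zero. So the vectors form
  a coset of an additive group in characteristic 3, or a group without its zero in characteristic 2;
  comparing the kernel and the image of a linear form on this group gives \<open>q \<le> 3\<close>. For \<open>2 q + 2\<close>
  points every point lies on exactly one secant with two points. Counting these secants modulo 3
  shows that \<open>3\<close> divides \<open>q\<close>, that they cover the plane, and therefore that they are concurrent; the
  common point can be added, which leads back to the case of \<open>2 q + 3\<close> points.
\<close>

section \<open>Determinants and arcs in the projective plane\<close>

datatype 'a vec3 = Vec3 (c1: 'a) (c2: 'a) (c3: 'a)

instantiation vec3 :: (ab_group_add) ab_group_add
begin

definition "0 = Vec3 0 0 0"
definition "a + b = Vec3 (c1 a + c1 b) (c2 a + c2 b) (c3 a + c3 b)"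
definition "a - b = Vec3 (c1 a - c1 b) (c2 a - c2 b) (c3 a - c3 b)"
definition "- a = Vec3 (- c1 a) (- c2 a) (- c3 a)"

instance
  by standard
    (simp_all add: zero_vec3_def plus_vec3_def minus_vec3_def uminus_vec3_def vec3.expand algebra_simps)

end

lemmas vec3_simps = zero_vec3_def plus_vec3_def minus_vec3_def uminus_vec3_def

definition det3 :: "'a::field vec3 \<Rightarrow> 'a vec3 \<Rightarrow> 'a vec3 \<Rightarrow> 'a" where
  "det3 a b c =
     c1 a * (c2 b * c3 c - c3 b * c2 c) - c2 a * (c1 b * c3 c - c3 b * c1 c)
     + c3 a * (c1 b * c2 c - c2 b * c1 c)"

definition scale3 :: "'a::field \<Rightarrow> 'a vec3 \<Rightarrow> 'a vec3" where
  "scale3 r a = Vec3 (r * c1 a) (r * c2 a) (r * c3 a)"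

text \<open>Linear independence of two vectors. In this form an independent pair comes with a third
  vector that completes it to a basis.\<close>

definition indep :: "'a::field vec3 \<Rightarrow> 'a vec3 \<Rightarrow> bool" where
  "indep a b \<longleftrightarrow> (\<exists>c. det3 a b c \<noteq> 0)"

definition line :: "'a::field vec3 set \<Rightarrow> 'a vec3 \<Rightarrow> 'a vec3 \<Rightarrow> 'a vec3 set" where
  "line G a b = {p \<in> G. det3 a b p = 0}"

text \<open>An (n,3)-arc in PG(2,q), given by vectors: \<open>indep\<close> makes distinct elements
  of \<open>G\<close> represent distinct projective points.\<close>

definition arc3 :: "'a::field vec3 set \<Rightarrow> bool" where
  "arc3 G \<longleftrightarrow> finite G \<and> (\<forall>a\<in>G. \<forall>b\<in>G. a \<noteq> b \<longrightarrow> indep a b \<and> card (line G a b) \<le> 3)"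

text \<open>The point (a : b) of the projective line, with \<open>None\<close> as the point at
  infinity. The pair (0, 0) is also sent to \<open>None\<close>, so it has to be excluded when
  slopes are compared.\<close>

definition slope :: "'a::field \<Rightarrow> 'a \<Rightarrow> 'a option" where
  "slope a b = (if b = 0 then None else Some (a / b))"

lemma slope_eq_iff:
  assumes "a \<noteq> 0 \<or> b \<noteq> 0" "c \<noteq> 0 \<or> d \<noteq> 0"
  shows "slope a b = slope c d \<longleftrightarrow> a * d = c * b"
  using assms by (auto simp: slope_def field_simps)

lemma det3_rotate: "det3 b c a = det3 a b c"
  by (simp add: det3_def vec3_simps algebra_simps)

lemma det3_swap: "det3 a c b = - det3 a b c"
  by (simp add: det3_def vec3_simps algebra_simps)

lemma det3_swap12: "det3 b a c = - det3 a b c"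
  by (simp add: det3_def vec3_simps algebra_simps)

lemma det3_same [simp]: "det3 a a b = 0" "det3 a b a = 0" "det3 b a a = 0"
  by (simp_all add: vec3_simps det3_def algebra_simps)

lemma det3_add: "det3 (a + a') b c = det3 a b c + det3 a' b c"
  "det3 a (b + b') c = det3 a b c + det3 a b' c"
  "det3 a b (c + c') = det3 a b c + det3 a b c'"
  by (simp_all add: vec3_simps det3_def algebra_simps)

lemma det3_scale: "det3 (scale3 r a) b c = r * det3 a b c"
  "det3 a (scale3 r b) c = r * det3 a b c"
  "det3 a b (scale3 r c) = r * det3 a b c"
  by (simp_all add: vec3_simps det3_def scale3_def algebra_simps)

lemma scale3_simps [simp]: "scale3 0 a = 0" "scale3 1 a = a" "scale3 r (scale3 r' a) = scale3 (r * r') a"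
  "scale3 r 0 = 0"
  by (simp_all add: vec3_simps scale3_def zero_vec3_def)

lemma scale3_add: "scale3 r (a + b) = scale3 r a + scale3 r b"
  "scale3 (r + r') a = scale3 r a + scale3 r' a"
  by (simp_all add: vec3_simps scale3_def algebra_simps)

text \<open>The three-term Pluecker relation for the alternating form \<open>det3 R\<close>, which
  lives on the plane obtained by factoring out \<open>R\<close>.\<close>

lemma det3_plucker:
  "det3 R x k * det3 R j y - det3 R y k * det3 R j x = det3 R x y * det3 R j k"
  by (simp add: det3_def vec3_simps algebra_simps)

lemma cramer:
  "scale3 (det3 i j k) p = scale3 (det3 p j k) i + scale3 (det3 i p k) j + scale3 (det3 i j p) k"
  by (simp add: det3_def vec3_simps scale3_def algebra_simps)

lemma indep_sym: "indep a b \<Longrightarrow> indep b a"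
  unfolding indep_def by (metis det3_swap12 neg_equal_0_iff_equal)

text \<open>Up to a common factor, the two determinants are the coordinates of \<open>p\<close>
  modulo \<open>R\<close> with respect to \<open>j\<close> and \<open>k\<close>.\<close>

lemma indep_coord:
  assumes "det3 R j k \<noteq> 0"
  shows "indep R p \<longleftrightarrow> det3 R p k \<noteq> 0 \<or> det3 R j p \<noteq> 0"
proof
  assume "indep R p"
  then obtain c where c: "det3 R p c \<noteq> 0" by (auto simp: indep_def)
  show "det3 R p k \<noteq> 0 \<or> det3 R j p \<noteq> 0"
    using det3_plucker[of R p k j c] c assms by auto
next
  assume "det3 R p k \<noteq> 0 \<or> det3 R j p \<noteq> 0"
  then show "indep R p" unfolding indep_def by (metis det3_swap neg_equal_0_iff_equal)
qed

lemma slope_det3_eq_iff: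
  assumes "det3 R j k \<noteq> 0" "indep R x" "indep R y"
  shows "slope (det3 R x k) (det3 R j x) = slope (det3 R y k) (det3 R j y) \<longleftrightarrow> det3 R x y = 0"
proof -
  have "slope (det3 R x k) (det3 R j x) = slope (det3 R y k) (det3 R j y)
    \<longleftrightarrow> det3 R x k * det3 R j y = det3 R y k * det3 R j x"
    using assms indep_coord[OF assms(1)] by (intro slope_eq_iff) blast+
  also have "\<dots> \<longleftrightarrow> det3 R x y * det3 R j k = 0"
    using det3_plucker[of R x k j y] by auto
  finally show ?thesis using assms by simp
qed

text \<open>\<open>f x\<close> names the line joining \<open>R\<close> to \<open>x\<close>. Its type
  has q + 1 elements, as many as there are lines through \<open>R\<close>, so summing over all
  fibres means summing over the pencil of \<open>R\<close>.\<close>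

lemma pencil_coordinate:
  fixes A :: "'a::field vec3 set"
  assumes "\<And>p. p \<in> A \<Longrightarrow> indep R p"
  shows "\<exists>f :: 'a vec3 \<Rightarrow> 'a option. \<forall>x\<in>A. \<forall>y\<in>A. f x = f y \<longleftrightarrow> det3 R x y = 0"
proof (cases "A = {}")
  case False
  then obtain j k where "det3 R j k \<noteq> 0" using assms unfolding indep_def by blast
  then show ?thesis
    by (intro exI[of _ "\<lambda>x. slope (det3 R x k) (det3 R j x)"] ballI slope_det3_eq_iff assms)
qed simp

lemma card_eq_sum_fibres:
  fixes f :: "'b \<Rightarrow> 'c::finite"
  assumes "finite A"
  shows "card A = (\<Sum>s\<in>UNIV. card {x \<in> A. f x = s})"
  using sum.group[of A UNIV f "\<lambda>_. 1::nat"] assms by simp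

lemma arc3_subset:
  assumes "arc3 G" "H \<subseteq> G"
  shows "arc3 H"
  unfolding arc3_def
proof (intro conjI ballI impI)
  show "finite H" using assms finite_subset by (auto simp: arc3_def)
  fix a b assume ab: "a \<in> H" "b \<in> H" "a \<noteq> b"
  then have *: "indep a b" "card (line G a b) \<le> 3" using assms by (auto simp: arc3_def)
  then show "indep a b" by simp
  have "card (line H a b) \<le> card (line G a b)"
    using assms by (intro card_mono) (auto simp: line_def arc3_def)
  then show "card (line H a b) \<le> 3" using * by simp
qed

lemma vec3_eq_iff: "a = b \<longleftrightarrow> c1 a = c1 b \<and> c2 a = c2 b \<and> c3 a = c3 b"
  by (cases a; cases b) simp

text \<open>Every nonempty fibre is a translate of the kernel. Closure under differences supplies 0,
  negatives and sums as soon as \<open>V\<close> has an element.\<close>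

lemma card_additive_image:
  fixes \<phi> :: "'b::ab_group_add \<Rightarrow> 'c::ab_group_add"
  assumes "finite V" and diff: "\<And>x y. x \<in> V \<Longrightarrow> y \<in> V \<Longrightarrow> x - y \<in> V"
    and hom: "\<And>x y. x \<in> V \<Longrightarrow> y \<in> V \<Longrightarrow> \<phi> (x - y) = \<phi> x - \<phi> y"
  shows "card V = card (\<phi> ` V) * card {x \<in> V. \<phi> x = 0}"
proof -
  have fib: "card {x \<in> V. \<phi> x = s} = card {x \<in> V. \<phi> x = 0}" if "s \<in> \<phi> ` V" for s
  proof -
    obtain y where y: "y \<in> V" "\<phi> y = s" using \<open>s \<in> \<phi> ` V\<close> by auto
    have plus: "x + z \<in> V \<and> \<phi> (x + z) = \<phi> x + \<phi> z" if "x \<in> V" "z \<in> V" for x z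
    proof -
      have 0: "0 \<in> V" "\<phi> 0 = 0" using diff[OF that(1) that(1)] hom[OF that(1) that(1)] by simp_all
      have m: "- z \<in> V" "\<phi> (- z) = - \<phi> z" using diff[OF 0(1) that(2)] hom[OF 0(1) that(2)] 0 by simp_all
      show ?thesis using diff[OF that(1) m(1)] hom[OF that(1) m(1)] m by simp
    qed
    show ?thesis
    proof (rule bij_betw_same_card[of "\<lambda>x. x - y"], rule bij_betw_byWitness[where f' = "\<lambda>x. x + y"])
      show "(\<lambda>x. x - y) ` {x \<in> V. \<phi> x = s} \<subseteq> {x \<in> V. \<phi> x = 0}"
      proof (rule image_subsetI)
        fix x assume "x \<in> {x \<in> V. \<phi> x = s}"
        then show "x - y \<in> {x \<in> V. \<phi> x = 0}" using diff[of x y] hom[of x y] y by simp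
      qed
      show "(\<lambda>x. x + y) ` {x \<in> V. \<phi> x = 0} \<subseteq> {x \<in> V. \<phi> x = s}"
      proof (rule image_subsetI)
        fix x assume "x \<in> {x \<in> V. \<phi> x = 0}"
        then show "x + y \<in> {x \<in> V. \<phi> x = s}" using plus[of x y] y by simp
      qed
    qed auto
  qed
  have "card V = (\<Sum>s\<in>\<phi> ` V. card {x \<in> V. \<phi> x = s})"
    using sum.group[of V "\<phi> ` V" \<phi> "\<lambda>_. 1::nat"] \<open>finite V\<close> by simp
  also have "\<dots> = (\<Sum>s\<in>\<phi> ` V. card {x \<in> V. \<phi> x = 0})"
    by (rule sum.cong[OF refl fib])
  finally show ?thesis by simp
qed

text \<open>Lagrange's theorem: the cosets of \<open>L\<close> partition the group into classes of
  size \<open>card L\<close>.\<close>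

lemma card_subgroup_dvd:
  fixes L :: "'b::{ab_group_add,finite} set"
  assumes "L \<noteq> {}" and diff: "\<And>x y. x \<in> L \<Longrightarrow> y \<in> L \<Longrightarrow> x - y \<in> L"
  shows "card L dvd CARD('b)"
proof -
  define coset where "coset x = {y. y - x \<in> L}" for x
  obtain l where "l \<in> L" using assms by blast
  then have 0: "0 \<in> L" using diff[of l l] by simp
  have minus: "- x \<in> L" if "x \<in> L" for x using diff[OF 0 that] by simp
  have plus: "x + y \<in> L" if "x \<in> L" "y \<in> L" for x y using diff[OF that(1) minus[OF that(2)]] by simp
  have "card L * card (range coset) = card (\<Union>(range coset))"
  proof (rule card_partition)
    fix c assume "c \<in> range coset"
    then obtain x where c: "c = coset x" by blast
    have "bij_betw (\<lambda>y. y - x) c L"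
      by (rule bij_betw_byWitness[where f' = "\<lambda>y. y + x"]) (auto simp: c coset_def)
    then show "card c = card L" by (rule bij_betw_same_card)
  next
    fix c d assume cd: "c \<in> range coset" "d \<in> range coset" "c \<noteq> d"
    then obtain x y where c: "c = coset x" and d: "d = coset y" by blast
    have sub: "coset x \<subseteq> coset y" if "z - x \<in> L" "z - y \<in> L" for x y z
    proof
      fix w assume "w \<in> coset x"
      then have "(w - x) - (z - x) + (z - y) \<in> L" using that
        by (intro plus[OF diff]) (auto simp: coset_def)
      then show "w \<in> coset y" by (simp add: coset_def)
    qed
    show "c \<inter> d = {}"
    proof (rule ccontr)
      assume "c \<inter> d \<noteq> {}"
      then obtain z where "z - x \<in> L" "z - y \<in> L" unfolding c d coset_def by blast
      then show False using sub[of z x y] sub[of z y x] cd(3) c d by simp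
    qed
  qed auto
  moreover have "\<Union>(range coset) = UNIV" using 0 by (auto simp: coset_def)
  ultimately show ?thesis by (metis dvd_triv_left)
qed

lemma indep_irrefl: "indep a b \<Longrightarrow> a \<noteq> b"
  by (auto simp: indep_def)

lemma indep_combination:
  assumes "indep a b" "det3 a b p = 0"
  obtains \<alpha> \<beta> where "p = scale3 \<alpha> a + scale3 \<beta> b"
proof -
  obtain c where c: "det3 a b c \<noteq> 0" using assms by (auto simp: indep_def)
  have "p = scale3 (1 / det3 a b c) (scale3 (det3 a b c) p)" using c by simp
  also have "\<dots> = scale3 (det3 p b c / det3 a b c) a + scale3 (det3 a p c / det3 a b c) b"
    using assms by (subst cramer) (simp add: scale3_add)
  finally show ?thesis using that by blast
qed

section \<open>Arcs with \<open>2 q + 3\<close> points\<close>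

locale maximal_arc =
  fixes G :: "'a::{field,finite} vec3 set"
  assumes arc: "arc3 G" and card_G: "card G = 2 * CARD('a) + 3"
begin

lemma finite_G: "finite G" using arc by (simp add: arc3_def)

lemma indep_G: "a \<in> G \<Longrightarrow> b \<in> G \<Longrightarrow> a \<noteq> b \<Longrightarrow> indep a b" using arc by (simp add: arc3_def)

text \<open>A nonempty fibre together with \<open>a\<close> is a line of \<open>G\<close>, so a
  fibre has at most two elements. The q + 1 fibres share the 2 q + 2 points of
  \<open>G - {a}\<close>, so none of them can be smaller.\<close>

lemma card_fibre:
  fixes f :: "'a vec3 \<Rightarrow> 'a option"
  assumes "a \<in> G" and f: "\<And>x y. x \<in> G - {a} \<Longrightarrow> y \<in> G - {a} \<Longrightarrow> f x = f y \<longleftrightarrow> det3 a x y = 0"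
  shows "card {x \<in> G - {a}. f x = s} = 2"
proof -
  have le: "card {x \<in> G - {a}. f x = s} \<le> 2" for s
  proof (cases "{x \<in> G - {a}. f x = s} = {}")
    case True then show ?thesis by (metis card.empty zero_le)
  next
    case False
    then obtain b where b: "b \<in> G - {a}" "f b = s" by blast
    then have eq: "insert a {x \<in> G - {a}. f x = s} = line G a b"
      using f assms by (auto simp: line_def det3_swap[of a _ b])
    moreover have "card (line G a b) \<le> 3" using arc b assms by (auto simp: arc3_def)
    moreover have "card (insert a {x \<in> G - {a}. f x = s}) = Suc (card {x \<in> G - {a}. f x = s})"
      using finite_G by simp
    ultimately show ?thesis by simp
  qed
  show ?thesis
  proof (rule ccontr)
    assume "card {x \<in> G - {a}. f x = s} \<noteq> 2"
    then have "card {x \<in> G - {a}. f x = s} < 2" using le[of s] by simp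
    then have "(\<Sum>s\<in>UNIV. card {x \<in> G - {a}. f x = s}) < (\<Sum>s\<in>(UNIV::'a option set). 2)"
      using le by (intro sum_strict_mono_ex1) auto
    also have "\<dots> = 2 * CARD('a) + 2" by (simp add: card_UNIV_option)
    finally show False
      using card_eq_sum_fibres[of "G - {a}" f] finite_G card_G assms by simp
  qed
qed

lemma card_line:
  assumes "a \<in> G" "b \<in> G" "a \<noteq> b"
  shows "card (line G a b) = 3"
proof -
  have ind: "indep a u" if "u \<in> G - {a}" for u using indep_G assms that by blast
  obtain f :: "'a vec3 \<Rightarrow> 'a option"
    where "\<forall>x\<in>G - {a}. \<forall>y\<in>G - {a}. f x = f y \<longleftrightarrow> det3 a x y = 0"
    by (rule exE[OF pencil_coordinate[OF ind]])
  then have f: "f x = f y \<longleftrightarrow> det3 a x y = 0" if "x \<in> G - {a}" "y \<in> G - {a}" for x y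
    using that by blast
  have "line G a b = insert a {x \<in> G - {a}. f x = f b}"
    using f[of b] assms by (auto simp: line_def eq_commute[of _ "f b"])
  then show ?thesis using card_fibre[OF assms(1) f, of "f b"] finite_G by simp
qed

lemma third_unique:
  assumes "a \<in> G" "b \<in> G" "a \<noteq> b" "x \<in> line G a b - {a,b}" "y \<in> line G a b - {a,b}"
  shows "x = y"
proof -
  have "{a,b} \<subseteq> line G a b" using assms(1,2) by (auto simp: line_def)
  then have "card (line G a b - {a,b}) = card (line G a b) - card {a,b}"
    by (intro card_Diff_subset) auto
  also have "\<dots> = 1" using card_line[OF assms(1-3)] assms(3) by simp
  finally have "card (line G a b - {a,b}) = 1" .
  then obtain z where z: "line G a b - {a,b} = {z}" by (rule card_1_singletonE)
  show ?thesis using assms(4,5) unfolding z by simp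
qed

section \<open>Third points of secants and Segre's lemma of tangents\<close>

lemma combination_third:
  assumes "a \<in> G" "b \<in> G" "a \<noteq> b" "\<kappa> \<noteq> 0" "\<rho> \<noteq> 0" "scale3 \<kappa> (a + scale3 \<rho> b) \<in> G"
  shows "scale3 \<kappa> (a + scale3 \<rho> b) \<in> line G a b - {a,b}"
proof -
  obtain c where c: "det3 a b c \<noteq> 0" using indep_G[OF assms(1-3)] by (auto simp: indep_def)
  define p where "p = scale3 \<kappa> (a + scale3 \<rho> b)"
  have "det3 a p c \<noteq> 0" "det3 p b c \<noteq> 0" "det3 a b p = 0"
    using c assms by (simp_all add: p_def det3_add det3_scale)
  then have "p \<noteq> a" "p \<noteq> b" by auto
  then show ?thesis using assms \<open>det3 a b p = 0\<close> by (simp add: line_def p_def)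
qed

text \<open>The coordinate of the third point of the secant through \<open>a\<close> and
  \<open>b\<close>, normalised so that \<open>a\<close> has coefficient 1. The factor \<kappa>
  accounts for the vector that represents this point in \<open>G\<close>.\<close>

definition ratio :: "'a vec3 \<Rightarrow> 'a vec3 \<Rightarrow> 'a" where
  "ratio a b = (SOME \<rho>. \<rho> \<noteq> 0 \<and> (\<exists>\<kappa>. \<kappa> \<noteq> 0 \<and> scale3 \<kappa> (a + scale3 \<rho> b) \<in> G))"

lemma ratio:
  assumes "a \<in> G" "b \<in> G" "a \<noteq> b"
  obtains \<kappa> where "\<kappa> \<noteq> 0" "scale3 \<kappa> (a + scale3 (ratio a b) b) \<in> G" "ratio a b \<noteq> 0"
proof -
  have "\<not> line G a b \<subseteq> {a,b}"
    using card_line[OF assms] card_mono[of "{a,b}" "line G a b"] by (auto simp: card_insert_if split: if_splits)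
  then obtain p where p: "p \<in> line G a b" "p \<noteq> a" "p \<noteq> b" by blast
  then obtain \<alpha> \<beta> where ab: "p = scale3 \<alpha> a + scale3 \<beta> b"
    using indep_combination[OF indep_G[OF assms], of p] by (auto simp: line_def)
  have pG: "p \<in> G" using p by (simp add: line_def)
  \<comment> \<open>\<open>p\<close> is independent of \<open>a\<close> and of \<open>b\<close>, so
    neither of its coefficients vanishes.\<close>
  obtain x y where "det3 a p x \<noteq> 0" "det3 b p y \<noteq> 0"
    using indep_G[of a p] indep_G[of b p] assms p pG by (auto simp: indep_def)
  then have nz: "\<alpha> \<noteq> 0" "\<beta> \<noteq> 0" using ab by (auto simp: det3_add det3_scale)
  then have "p = scale3 \<alpha> (a + scale3 (\<beta> / \<alpha>) b)" using ab by (simp add: scale3_add)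
  then have "\<exists>\<rho>. \<rho> \<noteq> 0 \<and> (\<exists>\<kappa>. \<kappa> \<noteq> 0 \<and> scale3 \<kappa> (a + scale3 \<rho> b) \<in> G)"
    using pG nz by (metis divide_eq_0_iff)
  then have "ratio a b \<noteq> 0 \<and> (\<exists>\<kappa>. \<kappa> \<noteq> 0 \<and> scale3 \<kappa> (a + scale3 (ratio a b) b) \<in> G)"
    unfolding ratio_def by (rule someI_ex)
  then show ?thesis using that by blast
qed

lemma ratio_eq:
  assumes "a \<in> G" "b \<in> G" "a \<noteq> b" "\<kappa> \<noteq> 0" "\<rho> \<noteq> 0" "scale3 \<kappa> (a + scale3 \<rho> b) \<in> G"
  shows "ratio a b = \<rho>"
proof -
  obtain \<mu> where \<mu>: "\<mu> \<noteq> 0" "scale3 \<mu> (a + scale3 (ratio a b) b) \<in> G" "ratio a b \<noteq> 0"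
    using ratio assms by metis
  have eq: "scale3 \<mu> (a + scale3 (ratio a b) b) = scale3 \<kappa> (a + scale3 \<rho> b)"
    using third_unique[OF assms(1-3)] combination_third[OF assms(1-3)] \<mu> assms(4-) by blast
  obtain c where c: "det3 a b c \<noteq> 0" using indep_G[OF assms(1-3)] by (auto simp: indep_def)
  have "\<mu> * (ratio a b * det3 a b c) = \<kappa> * (\<rho> * det3 a b c)" "\<mu> * det3 a b c = \<kappa> * det3 a b c"
    using arg_cong[OF eq, of "\<lambda>x. det3 a x c"] arg_cong[OF eq, of "\<lambda>x. det3 x b c"]
    by (simp_all add: det3_add det3_scale)
  then show ?thesis using c \<mu> by simp
qed

text \<open>The points concerned lie off the lines \<open>i j\<close> and \<open>i k\<close>, so
  their slopes seen from \<open>i\<close> are finite and nonzero. Each nonzero slope belongs to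
  exactly two of them, which makes the product the square of the product of all nonzero field
  elements.\<close>

lemma prod_slopes:
  assumes "i \<in> G" "j \<in> G" "k \<in> G" "det3 i j k \<noteq> 0"
  shows "(\<Prod>p\<in>{p \<in> G. det3 i p k \<noteq> 0 \<and> det3 i j p \<noteq> 0}. det3 i p k / det3 i j p) = 1"
proof -
  define P where "P = {p \<in> G. det3 i p k \<noteq> 0 \<and> det3 i j p \<noteq> 0}"
  define g where "g p = det3 i p k / det3 i j p" for p
  define f where "f p = slope (det3 i p k) (det3 i j p)" for p
  have f: "f x = f y \<longleftrightarrow> det3 i x y = 0" if "x \<in> G - {i}" "y \<in> G - {i}" for x y
    unfolding f_def using that assms indep_G by (intro slope_det3_eq_iff) auto
  have fib: "{p \<in> P. g p = c} = {p \<in> G - {i}. f p = Some c}" if "c \<noteq> 0" for c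
    using that assms by (auto simp: P_def g_def f_def slope_def split: if_splits)
  have "(\<Prod>p\<in>P. g p) = (\<Prod>c\<in>UNIV - {0}. \<Prod>p\<in>{p \<in> P. g p = c}. g p)"
    using finite_G by (intro prod.group[symmetric]) (auto simp: P_def g_def)
  also have "\<dots> = (\<Prod>c\<in>UNIV - {0}. c ^ 2)"
  proof (intro prod.cong refl)
    fix c :: 'a assume "c \<in> UNIV - {0}"
    then have "card {p \<in> P. g p = c} = 2" using fib card_fibre[OF assms(1) f] by simp
    then show "(\<Prod>p\<in>{p \<in> P. g p = c}. g p) = c\<^sup>2" by simp
  qed
  also have "\<dots> = (\<Prod>c\<in>UNIV - {0}. c) * (\<Prod>c\<in>UNIV - {0}. c)"
    by (simp add: power2_eq_square prod.distrib)
  also have "\<dots> = 1"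
  proof -
    \<comment> \<open>Inversion permutes the nonzero elements, so their product is its own
      inverse.\<close>
    have inv: "(\<Prod>c\<in>UNIV - {0::'a}. c) = (\<Prod>c\<in>UNIV - {0::'a}. inverse c)"
      by (rule prod.reindex_bij_witness[of _ inverse inverse]) auto
    have "(\<Prod>c\<in>UNIV - {0::'a}. c) * (\<Prod>c\<in>UNIV - {0::'a}. inverse c) = 1"
      unfolding prod.distrib[symmetric] by (intro prod.neutral) auto
    then show ?thesis by (simp flip: inv)
  qed
  finally show ?thesis unfolding P_def g_def .
qed

text \<open>Compared with \<open>prod_slopes\<close>, the points of the side \<open>j k\<close> are
  left out as well. The only one that occurred there is the third point of that side, and its slope
  is the inverse of \<open>ratio j k\<close>.\<close>

lemma prod_slopes_off_triangle:
  assumes "i \<in> G" "j \<in> G" "k \<in> G" "det3 i j k \<noteq> 0"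
  shows "(\<Prod>p\<in>{p \<in> G. det3 p j k \<noteq> 0 \<and> det3 i p k \<noteq> 0 \<and> det3 i j p \<noteq> 0}.
    det3 i p k / det3 i j p) = ratio j k" (is "prod _ ?Q = _")
proof -
  have jk: "j \<noteq> k" using assms by auto
  obtain \<kappa> where \<kappa>: "\<kappa> \<noteq> 0" "scale3 \<kappa> (j + scale3 (ratio j k) k) \<in> G" and r: "ratio j k \<noteq> 0"
    using ratio[OF assms(2,3) jk] by metis
  define a where "a = scale3 \<kappa> (j + scale3 (ratio j k) k)"
  have a: "a \<in> line G j k - {j,k}"
    unfolding a_def using combination_third assms jk \<kappa> r by blast
  have da: "det3 i a k = \<kappa> * det3 i j k" "det3 i j a = \<kappa> * ratio j k * det3 i j k" "det3 a j k = 0"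
    by (simp_all add: a_def det3_add det3_scale)
  have uniq: "p = a" if "p \<in> G" "det3 p j k = 0" "det3 i p k \<noteq> 0" "det3 i j p \<noteq> 0" for p
    using that a by (intro third_unique[OF assms(2,3) jk]) (auto simp: line_def det3_rotate[of j k p])
  then have eq: "{p \<in> G. det3 i p k \<noteq> 0 \<and> det3 i j p \<noteq> 0} = insert a ?Q"
  proof -
    have "a \<in> G" "det3 i a k \<noteq> 0" "det3 i j a \<noteq> 0"
      using a da \<kappa> r assms by (auto simp: line_def)
    then show ?thesis using uniq by blast
  qed
  have "a \<notin> ?Q" using da by simp
  then have "1 = det3 i a k / det3 i j a * (\<Prod>p\<in>?Q. det3 i p k / det3 i j p)"
    using prod_slopes[OF assms] finite_G unfolding eq by simp
  then show ?thesis using da \<kappa> r assms by (simp add: field_simps)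
qed

text \<open>Each ratio is a product over the same set, the points on no side of the triangle. The
  slopes of such a point seen from the three vertices have product 1, as in Ceva's theorem.\<close>

lemma ratio_triangle:
  assumes "i \<in> G" "j \<in> G" "k \<in> G" "det3 i j k \<noteq> 0"
  shows "ratio i j * ratio j k * ratio k i = 1"
proof -
  define Q where "Q = {p \<in> G. det3 p j k \<noteq> 0 \<and> det3 i p k \<noteq> 0 \<and> det3 i j p \<noteq> 0}"
  have rot: "det3 j k i = det3 i j k" "det3 k i j = det3 i j k"
    by (simp_all add: det3_def algebra_simps)
  have r: "det3 p k i = det3 i p k" "det3 j p i = det3 i j p" "det3 j k p = det3 p j k"
    "det3 p i j = det3 i j p" "det3 k p j = det3 p j k" "det3 k i p = det3 i p k" for p
    by (simp_all add: det3_def algebra_simps)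
  have 1: "(\<Prod>p\<in>Q. det3 i p k / det3 i j p) = ratio j k"
    unfolding Q_def by (rule prod_slopes_off_triangle) fact+
  have 2: "(\<Prod>p\<in>Q. det3 i j p / det3 p j k) = ratio k i"
  proof -
    have Q: "Q = {p \<in> G. det3 p k i \<noteq> 0 \<and> det3 j p i \<noteq> 0 \<and> det3 j k p \<noteq> 0}"
      by (auto simp: Q_def r)
    show ?thesis using prod_slopes_off_triangle[of j k i] assms rot unfolding Q by (simp add: r)
  qed
  have 3: "(\<Prod>p\<in>Q. det3 p j k / det3 i p k) = ratio i j"
  proof -
    have Q: "Q = {p \<in> G. det3 p i j \<noteq> 0 \<and> det3 k p j \<noteq> 0 \<and> det3 k i p \<noteq> 0}"
      by (auto simp: Q_def r)
    show ?thesis using prod_slopes_off_triangle[of k i j] assms rot unfolding Q by (simp add: r)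
  qed
  have "ratio i j * ratio j k * ratio k i
    = (\<Prod>p\<in>Q. det3 p j k / det3 i p k * (det3 i p k / det3 i j p) * (det3 i j p / det3 p j k))"
    unfolding 1[symmetric] 2[symmetric] 3[symmetric] by (simp only: prod.distrib)
  also have "\<dots> = 1" by (intro prod.neutral) (auto simp: Q_def)
  finally show ?thesis .
qed

lemma ratio_sym:
  assumes "a \<in> G" "b \<in> G" "a \<noteq> b"
  shows "ratio b a = inverse (ratio a b)"
proof -
  obtain \<kappa> where \<kappa>: "\<kappa> \<noteq> 0" "scale3 \<kappa> (a + scale3 (ratio a b) b) \<in> G" and r: "ratio a b \<noteq> 0"
    using ratio[OF assms] by metis
  have "scale3 \<kappa> (a + scale3 (ratio a b) b)
    = scale3 (\<kappa> * ratio a b) (b + scale3 (inverse (ratio a b)) a)"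
    using r by (simp add: scale3_add add.commute mult.assoc)
  then show ?thesis using assms \<kappa> r by (intro ratio_eq[of b a "\<kappa> * ratio a b"]) auto
qed

text \<open>Solving \<open>c = scale3 \<kappa> (a + scale3 \<rho> b)\<close> for \<open>a\<close>
  and for \<open>b\<close> exhibits each of the three points as the third point of the other
  two.\<close>

lemma ratio_collinear:
  assumes "a \<in> G" "b \<in> G" "a \<noteq> b" "\<kappa> \<noteq> 0" "\<rho> \<noteq> 0" "c = scale3 \<kappa> (a + scale3 \<rho> b)" "c \<in> G"
  shows "ratio a b = \<rho>" "ratio b c = - inverse (\<kappa> * \<rho>)" "ratio c a = - \<kappa>" "c \<noteq> a" "c \<noteq> b"
proof -
  show "ratio a b = \<rho>" using ratio_eq assms by simp
  show c: "c \<noteq> a" "c \<noteq> b" using combination_third[of a b \<kappa> \<rho>] assms by auto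
  have "a = scale3 (- \<rho>) (b + scale3 (- inverse (\<kappa> * \<rho>)) c)"
    using assms(4,5) by (simp add: assms(6) vec3_eq_iff vec3_simps scale3_def field_simps)
  then show "ratio b c = - inverse (\<kappa> * \<rho>)"
    using assms(1-5,7) c by (intro ratio_eq[of b c "- \<rho>"]) auto
  have "b = scale3 (inverse (\<kappa> * \<rho>)) (c + scale3 (- \<kappa>) a)"
    using assms(4,5) by (simp add: assms(6) vec3_eq_iff vec3_simps scale3_def field_simps)
  then show "ratio c a = - \<kappa>"
    using assms(1-5,7) c by (intro ratio_eq[of c a "inverse (\<kappa> * \<rho>)"]) auto
qed

text \<open>\<open>ratio_triangle\<close> covers three points in general position. Three collinear
  points form a whole secant, where the ratios are explicit: \<rho>, -1/(\<kappa> \<rho>) and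
  -\<kappa>.\<close>

lemma ratio_cocycle:
  assumes "a \<in> G" "b \<in> G" "c \<in> G" "a \<noteq> b" "b \<noteq> c" "a \<noteq> c"
  shows "ratio a b * ratio b c * ratio c a = 1"
proof (cases "det3 a b c = 0")
  case True
  obtain \<kappa> where \<kappa>: "\<kappa> \<noteq> 0" "scale3 \<kappa> (a + scale3 (ratio a b) b) \<in> G" and r: "ratio a b \<noteq> 0"
    using ratio assms by metis
  have "c = scale3 \<kappa> (a + scale3 (ratio a b) b)"
    using True assms combination_third[OF assms(1,2,4) \<kappa>(1) r \<kappa>(2)]
    by (intro third_unique[OF assms(1,2,4)]) (auto simp: line_def)
  from ratio_collinear[OF assms(1,2,4) \<kappa>(1) r this assms(3)] show ?thesis
    using \<kappa> r by (simp add: field_simps)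
next
  case False then show ?thesis using ratio_triangle assms by simp
qed

text \<open>
  The third points satisfy the cocycle identity \<open>ratio_cocycle\<close>, so \<open>ratio\<close> is a coboundary:
  after rescaling the representatives, the three points of every secant sum to zero.
\<close>

lemma zero_sum_representatives:
  obtains f where "\<And>a. a \<in> G \<Longrightarrow> f a \<noteq> 0"
    and "\<And>a b. a \<in> G \<Longrightarrow> b \<in> G \<Longrightarrow> a \<noteq> b \<Longrightarrow>
      \<exists>c\<in>G. scale3 (f a) a + scale3 (f b) b + scale3 (f c) c = 0"
proof -
  obtain z where z: "z \<in> G" using card_G by (metis card.empty ex_in_conv not_numeral_le_zero le_add2)
  \<comment> \<open>A cocycle is the coboundary of its values against a fixed base point
    \<open>z\<close>; the value 1 at \<open>z\<close> itself keeps the formula \<open>r\<close>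
    below valid there.\<close>
  define f where "f p = (if p = z then 1 else ratio z p)" for p
  have nz: "f a \<noteq> 0" if "a \<in> G" for a using ratio that z by (metis f_def one_neq_zero)
  have r: "ratio a b = f b / f a" if ab: "a \<in> G" "b \<in> G" "a \<noteq> b" for a b
  proof -
    consider "a = z" | "b = z" | "a \<noteq> z" "b \<noteq> z" by blast
    then show ?thesis
    proof cases
      case 1 then show ?thesis using ab by (simp add: f_def)
    next
      case 2 then show ?thesis using ab ratio_sym[OF ab(2,1)] by (simp add: f_def field_simps)
    next
      case 3
      then have "ratio z a * ratio a b * inverse (ratio z b) = 1"
        using ratio_cocycle[of z a b] ratio_sym[of z b] ab z by simp
      then show ?thesis using 3 nz[OF ab(1)] nz[OF ab(2)] by (simp add: f_def field_simps)
    qed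
  qed
  show ?thesis
  proof (rule that[OF nz])
    fix a b assume ab: "a \<in> G" "b \<in> G" "a \<noteq> b"
    obtain \<kappa> where \<kappa>: "\<kappa> \<noteq> 0" "scale3 \<kappa> (a + scale3 (ratio a b) b) \<in> G" and r0: "ratio a b \<noteq> 0"
      using ratio[OF ab] by metis
    define c where "c = scale3 \<kappa> (a + scale3 (ratio a b) b)"
    have cG: "c \<in> G" using \<kappa> by (simp add: c_def)
    note col = ratio_collinear[OF ab \<kappa>(1) r0 c_def cG]
    have "f c / f b = - inverse (\<kappa> * (f b / f a))"
      using col(2) r[OF ab(2) cG] r[OF ab] col(5) by simp
    then have fc: "f c = - f a / \<kappa>" using nz[OF ab(1)] nz[OF ab(2)] \<kappa> by (simp add: field_simps)
    have "scale3 (f a) a + scale3 (f b) b + scale3 (f c) c = 0"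
      unfolding fc using nz[OF ab(1)] \<kappa>(1)
      by (simp add: c_def r[OF ab] vec3_eq_iff vec3_simps scale3_def field_simps)
    then show "\<exists>c\<in>G. scale3 (f a) a + scale3 (f b) b + scale3 (f c) c = 0" using cG by blast
  qed
qed

text \<open>Passing to the representatives that sum to zero changes determinants only by nonzero
  factors, so independence and the size of the lines survive.\<close>

lemma zero_sum_set:
  obtains S :: "'a vec3 set" where "finite S" "card S = 2 * CARD('a) + 3"
    and "\<And>x y. x \<in> S \<Longrightarrow> y \<in> S \<Longrightarrow> x \<noteq> y \<Longrightarrow> - (x + y) \<in> S"
    and "\<And>x y. x \<in> S \<Longrightarrow> y \<in> S \<Longrightarrow> x \<noteq> y \<Longrightarrow> indep x y"
    and "\<And>x y. x \<in> S \<Longrightarrow> y \<in> S \<Longrightarrow> x \<noteq> y \<Longrightarrow> card (line S x y) = 3"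
proof -
  obtain f where nz: "\<And>a. a \<in> G \<Longrightarrow> f a \<noteq> 0"
    and sum0: "\<And>a b. a \<in> G \<Longrightarrow> b \<in> G \<Longrightarrow> a \<noteq> b \<Longrightarrow>
      \<exists>c\<in>G. scale3 (f a) a + scale3 (f b) b + scale3 (f c) c = 0"
    by (rule zero_sum_representatives) blast
  define h where "h a = scale3 (f a) a" for a
  have ind: "indep (h a) (h b)" if ab: "a \<in> G" "b \<in> G" "a \<noteq> b" for a b
  proof -
    obtain c where "det3 a b c \<noteq> 0" using indep_G[OF ab] by (auto simp: indep_def)
    then have "det3 (h a) (h b) c \<noteq> 0" using nz ab by (simp add: h_def det3_scale)
    then show ?thesis by (auto simp: indep_def)
  qed
  have inj: "inj_on h G" by (rule inj_onI) (metis ind indep_irrefl)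
  show ?thesis
  proof (rule that[of "h ` G"])
    show "finite (h ` G)" using finite_G by simp
    show "card (h ` G) = 2 * CARD('a) + 3" using inj card_G by (simp add: card_image)
    fix x y assume "x \<in> h ` G" "y \<in> h ` G" "x \<noteq> y"
    then obtain a b where ab: "x = h a" "y = h b" "a \<in> G" "b \<in> G" "a \<noteq> b" by blast
    show "indep x y" using ind ab by simp
    obtain c where c: "c \<in> G" "h a + h b + h c = 0" using sum0[OF ab(3-5)] by (auto simp: h_def)
    then have "- (x + y) = h c" unfolding ab by (simp only: add_eq_0_iff)
    then show "- (x + y) \<in> h ` G" using c by simp
    have "line (h ` G) x y = h ` line G a b"
      using nz ab by (auto simp: line_def h_def det3_scale)
    then show "card (line (h ` G) x y) = 3"
      using card_line[OF ab(3-5)] inj by (simp add: card_image inj_on_subset line_def)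
  qed
qed

text \<open>The linear form \<open>det3 x y\<close> maps an additive group built from
  \<open>S\<close> onto a group of order m dividing q, and its kernel is read off from the
  three-point line through \<open>x\<close> and \<open>y\<close>. This gives 2 q + 3 = 3 m in
  characteristic 3 and 2 q + 4 = 4 m in characteristic 2; other characteristics cannot
  occur.\<close>

lemma CARD_le_3: "CARD('a) \<le> 3"
proof -
  let ?q = "CARD('a)"
  obtain S :: "'a vec3 set" where fin: "finite S" and card_S: "card S = 2 * ?q + 3"
    and sum: "\<And>x y. x \<in> S \<Longrightarrow> y \<in> S \<Longrightarrow> x \<noteq> y \<Longrightarrow> - (x + y) \<in> S"
    and ind: "\<And>x y. x \<in> S \<Longrightarrow> y \<in> S \<Longrightarrow> x \<noteq> y \<Longrightarrow> indep x y"
    and line3: "\<And>x y. x \<in> S \<Longrightarrow> y \<in> S \<Longrightarrow> x \<noteq> y \<Longrightarrow> card (line S x y) = 3"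
    by (rule zero_sum_set) blast
  have big: "\<exists>p\<in>S. p \<notin> T" if "finite T" "card T \<le> 3" for T
  proof (rule ccontr)
    assume "\<not> ?thesis"
    then have "S \<subseteq> T" by blast
    then have "card S \<le> card T" using that(1) by (rule card_mono[rotated])
    then show False using card_S that(2) zero_less_card_finite[where 'a = 'a] by linarith
  qed
  obtain x where x: "x \<in> S" using big[of "{}"] by auto
  obtain y where y: "y \<in> S" "x \<noteq> y" using big[of "{x}"] by auto
  have "finite (line S x y)" using fin by (simp add: line_def)
  then obtain z where z: "z \<in> S" "det3 x y z \<noteq> 0"
    using big[of "line S x y"] line3[OF x y] by (auto simp: line_def)
  let ?\<phi> = "\<lambda>p. det3 x y p"
  have hom: "?\<phi> (p - r) = ?\<phi> p - ?\<phi> r" for p r by (simp add: det3_def vec3_simps algebra_simps)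
  have subgroup_bound: "\<exists>m. m dvd ?q \<and> card L = m * card {p \<in> L. ?\<phi> p = 0}"
    if "finite L" "L \<noteq> {}" and diff: "\<And>p r. p \<in> L \<Longrightarrow> r \<in> L \<Longrightarrow> p - r \<in> L" for L
  proof (intro exI conjI)
    show "card L = card (?\<phi> ` L) * card {p \<in> L. ?\<phi> p = 0}"
      by (rule card_additive_image[OF that(1) diff hom])
    show "card (?\<phi> ` L) dvd ?q"
    proof (rule card_subgroup_dvd)
      fix u v assume "u \<in> ?\<phi> ` L" "v \<in> ?\<phi> ` L"
      then obtain p r where "p \<in> L" "r \<in> L" "u - v = ?\<phi> (p - r)" using hom by auto
      then show "u - v \<in> ?\<phi> ` L" using diff by blast
    qed (use that(2) in simp)
  qed
  show ?thesis
  proof (cases "(1::'a) + 1 + 1 = 0")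
    case True
    \<comment> \<open>In characteristic 3 the closure rule also holds for equal points, since -2 p =
      p.\<close>
    have three: "- (p + p) = p" for p :: "'a vec3"
    proof -
      have "- (a + a) = a" for a :: 'a
        using arg_cong[OF True, of "\<lambda>t. a * t"] by (simp add: algebra_simps neg_eq_iff_add_eq_0)
      then show ?thesis by (simp add: vec3_eq_iff vec3_simps)
    qed
    have sum': "- (p + r) \<in> S" if "p \<in> S" "r \<in> S" for p r
      using sum three that by (cases "p = r") auto
    \<comment> \<open>By the closure rule \<open>S\<close> is a coset; translating by
      \<open>x\<close> moves it to the subgroup itself.\<close>
    define L where "L = (\<lambda>p. p - x) ` S"
    have diff: "p - r \<in> L" if L: "p \<in> L" "r \<in> L" for p r
    proof -
      obtain p' r' where pr: "p' \<in> S" "r' \<in> S" "p = p' - x" "r = r' - x" using L by (auto simp: L_def)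
      have "- (- (p' + x) + r') \<in> S" by (intro sum' pr x)
      moreover have "p - r = - (- (p' + x) + r') - x" using pr by simp
      ultimately show ?thesis unfolding L_def by (rule rev_image_eqI)
    qed
    obtain m where m: "m dvd ?q" "card L = m * card {p \<in> L. ?\<phi> p = 0}"
      using subgroup_bound[OF _ _ diff] fin x by (auto simp: L_def)
    \<comment> \<open>As the form vanishes at \<open>x\<close>, the kernel is a translate of the
      line through \<open>x\<close> and \<open>y\<close>.\<close>
    have "{p \<in> L. ?\<phi> p = 0} = (\<lambda>p. p - x) ` line S x y"
      by (auto simp: L_def line_def hom)
    then have "card {p \<in> L. ?\<phi> p = 0} = 3"
      using line3[OF x y] by (simp add: card_image inj_on_def)
    moreover have "card L = 2 * ?q + 3" using card_S by (simp add: L_def card_image inj_on_def)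
    ultimately have e: "2 * ?q + 3 = 3 * m" using m by simp
    then have "m dvd 2 * ?q + 3" by simp
    \<comment> \<open>m divides both q and 2 q + 3.\<close>
    then have "m dvd 3" using m(1) by (metis dvd_add_right_iff dvd_mult)
    then have "m \<le> 3" by (simp add: dvd_imp_le)
    then show ?thesis using e by simp
  next
    case False
    have xz: "x \<noteq> z" "y \<noteq> z" using z by auto
    have a: "- (x + y) \<in> S" "- (x + z) \<in> S" using sum x y z xz by auto
    have "- (x + y) \<noteq> z"
    proof
      assume *: "- (x + y) = z"
      have "det3 x y (- (x + y)) = 0" by (simp add: det3_def vec3_simps algebra_simps)
      then show False using * z by simp
    qed
    have "- (x + z) \<noteq> y"
    proof
      assume *: "- (x + z) = y"
      have "det3 x (- (x + z)) z = 0" by (simp add: det3_def vec3_simps algebra_simps)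
      then show False using * z by simp
    qed
    \<comment> \<open>The closure rule is applied to -(x + y) and \<open>z\<close>, and to -(x + z)
      and \<open>y\<close>; the inequalities above make it applicable.\<close>
    have b: "x + y - z \<in> S" "x + z - y \<in> S"
      using sum[OF a(1) z(1)] sum[OF a(2) y(1)] \<open>- (x + y) \<noteq> z\<close> \<open>- (x + z) \<noteq> y\<close>
      by (simp_all add: algebra_simps)
    \<comment> \<open>If the two points differed, the negative of their sum, -2 x, would be in
      \<open>S\<close>. Being dependent on \<open>x\<close> it would equal \<open>x\<close>, so 3 x
      = 0, which is excluded in this case.\<close>
    have eq: "x + y - z = x + z - y"
    proof (rule ccontr)
      assume "x + y - z \<noteq> x + z - y"
      from sum[OF b this] have S: "- (x + x) \<in> S" by (simp add: algebra_simps)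
      have "\<not> indep x (- (x + x))"
        by (auto simp: indep_def det3_def vec3_simps algebra_simps)
      then have *: "x = - (x + x)" using ind[OF x S] by blast
      have "(1 + 1 + 1) * det3 x y z = det3 (x - (- (x + x))) y z"
        by (simp add: det3_def vec3_simps algebra_simps)
      also have "x - (- (x + x)) = 0" using * by simp
      also have "det3 0 y z = 0" by (simp add: det3_def vec3_simps)
      finally show False using False z by simp
    qed
    \<comment> \<open>The equality just shown says 2 y = 2 z, while \<open>y\<close> and
      \<open>z\<close> are independent modulo \<open>x\<close>.\<close>
    have two: "(1::'a) + 1 = 0"
    proof -
      have "(1 + 1) * det3 x y z = det3 x ((x + y - z) - (x + z - y)) z"
        by (simp add: det3_def vec3_simps algebra_simps)
      also have "(x + y - z) - (x + z - y) = 0" using eq by simp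
      also have "det3 x 0 z = 0" by (simp add: det3_def vec3_simps)
      finally show ?thesis using z by simp
    qed
    have neg: "- p = p" for p :: "'a vec3"
    proof -
      have "- a = a" for a :: 'a
        using arg_cong[OF two, of "\<lambda>t. a * t"] by (simp add: algebra_simps neg_eq_iff_add_eq_0)
      then show ?thesis by (simp add: vec3_eq_iff vec3_simps)
    qed
    have "0 \<notin> S"
    proof
      assume "0 \<in> S"
      then obtain p where "p \<in> S" "p \<noteq> 0" using x y by metis
      then have "indep 0 p" using ind \<open>0 \<in> S\<close> by simp
      then show False by (simp add: indep_def det3_def vec3_simps)
    qed
    \<comment> \<open>In characteristic 2 the closure rule says that distinct elements of
      \<open>S\<close> have their sum in \<open>S\<close>; only the sums p + p = 0 have to be added
      to obtain a group.\<close>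
    define L where "L = insert 0 S"
    have diff: "p - r \<in> L" if "p \<in> L" "r \<in> L" for p r
    proof -
      have e: "p - r = - (p + r)" by (metis diff_conv_add_uminus neg)
      show ?thesis
      proof (cases "p = r \<or> p = 0 \<or> r = 0")
        case True then show ?thesis using that neg by (auto simp: L_def)
      next
        case False then show ?thesis unfolding e using that sum by (auto simp: L_def)
      qed
    qed
    obtain m where m: "m dvd ?q" "card L = m * card {p \<in> L. ?\<phi> p = 0}"
      using subgroup_bound[OF _ _ diff] fin by (auto simp: L_def)
    have "det3 x y 0 = 0" by (simp add: det3_def vec3_simps)
    then have "{p \<in> L. ?\<phi> p = 0} = insert 0 (line S x y)" "0 \<notin> line S x y"
      using \<open>0 \<notin> S\<close> by (auto simp: L_def line_def)
    then have "card {p \<in> L. ?\<phi> p = 0} = 4"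
      using line3[OF x y] fin by (simp add: line_def)
    moreover have "card L = 2 * ?q + 4" using card_S fin \<open>0 \<notin> S\<close> by (simp add: L_def)
    ultimately have e: "?q + 2 = 2 * m" using m by simp
    then have "m dvd ?q + 2" by simp
    then have "m dvd 2" using m(1) by (metis dvd_add_right_iff)
    then have "m \<le> 2" by (simp add: dvd_imp_le)
    then show ?thesis using e by simp
  qed
qed

end

section \<open>Arcs with \<open>2 q + 2\<close> points\<close>

text \<open>Both conditions put \<open>y\<close> on the same line: \<open>x\<close> lies on the line
  \<open>R p\<close> and is not a multiple of \<open>p\<close>.\<close>

lemma det3_line_eq_iff:
  assumes "indep R p" "indep p x" "det3 R p x = 0"
  shows "det3 R p y = 0 \<longleftrightarrow> det3 p x y = 0"
proof -
  obtain \<alpha> \<beta> where x: "x = scale3 \<alpha> R + scale3 \<beta> p"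
    using indep_combination[OF assms(1,3)] by metis
  have *: "det3 p x z = - \<alpha> * det3 R p z" for z
    by (simp add: x det3_add det3_scale det3_swap12[of p R])
  have "\<alpha> \<noteq> 0" using assms(2) by (auto simp: indep_def *)
  then show ?thesis by (simp add: *)
qed

locale deficient_arc =
  fixes G :: "'a::{field,finite} vec3 set"
  assumes arc: "arc3 G" and card_G: "card G = 2 * CARD('a) + 2"
begin

lemma finite_G: "finite G" using arc by (simp add: arc3_def)

lemma indep_G: "a \<in> G \<Longrightarrow> b \<in> G \<Longrightarrow> a \<noteq> b \<Longrightarrow> indep a b" using arc by (simp add: arc3_def)

text \<open>The deficits 2 - card are nonnegative, and over the q + 1 fibres they add up to 2 (q +
  1) - (2 q + 1) = 1. Hence exactly one fibre is short, by one point.\<close>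

lemma card_fibre:
  fixes f :: "'a vec3 \<Rightarrow> 'a option"
  assumes "a \<in> G" and f: "\<And>x y. x \<in> G - {a} \<Longrightarrow> y \<in> G - {a} \<Longrightarrow> f x = f y \<longleftrightarrow> det3 a x y = 0"
  obtains s\<^sub>0 where "card {x \<in> G - {a}. f x = s\<^sub>0} = 1"
    "\<forall>s. s \<noteq> s\<^sub>0 \<longrightarrow> card {x \<in> G - {a}. f x = s} = 2"
proof -
  have le: "card {x \<in> G - {a}. f x = s} \<le> 2" for s
  proof (cases "{x \<in> G - {a}. f x = s} = {}")
    case True then show ?thesis by (metis card.empty zero_le)
  next
    case False
    then obtain b where b: "b \<in> G - {a}" "f b = s" by blast
    then have eq: "insert a {x \<in> G - {a}. f x = s} = line G a b"
      using f assms by (auto simp: line_def det3_swap[of a _ b])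
    moreover have "card (line G a b) \<le> 3" using arc b assms by (auto simp: arc3_def)
    moreover have "card (insert a {x \<in> G - {a}. f x = s}) = Suc (card {x \<in> G - {a}. f x = s})"
      using finite_G by simp
    ultimately show ?thesis by simp
  qed
  let ?u = "\<lambda>s. 2 - card {x \<in> G - {a}. f x = s}"
  have "(\<Sum>s\<in>UNIV. ?u s) + (\<Sum>s\<in>UNIV. card {x \<in> G - {a}. f x = s}) = (\<Sum>s\<in>(UNIV::'a option set). 2)"
    unfolding sum.distrib[symmetric] by (intro sum.cong refl) (use le in simp)
  moreover have "(\<Sum>s\<in>(UNIV::'a option set). 2) = 2 * CARD('a) + (2::nat)" by (simp add: card_UNIV_option)
  moreover have "(\<Sum>s\<in>UNIV. card {x \<in> G - {a}. f x = s}) = 2 * CARD('a) + 1"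
    using card_eq_sum_fibres[of "G - {a}" f] finite_G card_G assms(1) by simp
  ultimately have "(\<Sum>s\<in>UNIV. ?u s) = 1" by simp
  then obtain s\<^sub>0 where s\<^sub>0: "?u s\<^sub>0 = 1" "\<And>s. s \<noteq> s\<^sub>0 \<Longrightarrow> ?u s = 0"
    using sum_eq_1_iff[of UNIV ?u] by auto
  show ?thesis
  proof (rule that)
    show "card {x \<in> G - {a}. f x = s\<^sub>0} = 1" using s\<^sub>0(1) by linarith
    have "card {x \<in> G - {a}. f x = s} = 2" if "s \<noteq> s\<^sub>0" for s
      using s\<^sub>0(2)[OF that] le[of s] by linarith
    then show "\<forall>s. s \<noteq> s\<^sub>0 \<longrightarrow> card {x \<in> G - {a}. f x = s} = 2" by blast
  qed
qed

text \<open>The short fibre of the pencil at \<open>a\<close> is the only two-point secant through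
  \<open>a\<close>; all other lines through \<open>a\<close> carry two further points.\<close>

lemma ex_partner:
  assumes "a \<in> G"
  shows "\<exists>b\<in>G. b \<noteq> a \<and> line G a b = {a, b} \<and> (\<forall>c\<in>G. c \<noteq> a \<longrightarrow> c \<noteq> b \<longrightarrow> card (line G a c) = 3)"
proof -
  have ind: "indep a u" if "u \<in> G - {a}" for u using indep_G assms that by blast
  obtain f :: "'a vec3 \<Rightarrow> 'a option"
    where "\<forall>x\<in>G - {a}. \<forall>y\<in>G - {a}. f x = f y \<longleftrightarrow> det3 a x y = 0"
    by (rule exE[OF pencil_coordinate[OF ind]])
  then have f: "f x = f y \<longleftrightarrow> det3 a x y = 0" if "x \<in> G - {a}" "y \<in> G - {a}" for x y
    using that by blast
  obtain s\<^sub>0 where s\<^sub>0: "card {x \<in> G - {a}. f x = s\<^sub>0} = 1"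
    "\<forall>s. s \<noteq> s\<^sub>0 \<longrightarrow> card {x \<in> G - {a}. f x = s} = 2"
    by (rule card_fibre[OF assms f])
  have ln: "line G a c = insert a {x \<in> G - {a}. f x = f c}" if "c \<in> G - {a}" for c
    using f[OF that] that assms by (auto simp: line_def eq_commute[of _ "f c"])
  obtain b where b: "{x \<in> G - {a}. f x = s\<^sub>0} = {b}" using s\<^sub>0(1) by (rule card_1_singletonE)
  have b': "b \<in> G" "b \<noteq> a" "f b = s\<^sub>0" using b by auto
  show ?thesis
  proof (intro bexI[of _ b] conjI ballI impI)
    show "line G a b = {a, b}" using ln[of b] b b' by simp
    fix c assume c: "c \<in> G" "c \<noteq> a" "c \<noteq> b"
    then have "f c \<noteq> s\<^sub>0" using b by auto
    then show "card (line G a c) = 3" using ln[of c] s\<^sub>0(2) c finite_G by simp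
  qed (use b' in auto)
qed

definition partner :: "'a vec3 \<Rightarrow> 'a vec3" where
  "partner a = (SOME b. b \<in> G \<and> b \<noteq> a \<and> line G a b = {a, b} \<and>
     (\<forall>c\<in>G. c \<noteq> a \<longrightarrow> c \<noteq> b \<longrightarrow> card (line G a c) = 3))"

lemma partner:
  assumes "a \<in> G"
  shows "partner a \<in> G" "partner a \<noteq> a" "line G a (partner a) = {a, partner a}"
    "\<And>c. c \<in> G \<Longrightarrow> c \<noteq> a \<Longrightarrow> c \<noteq> partner a \<Longrightarrow> card (line G a c) = 3"
proof -
  have "partner a \<in> G \<and> partner a \<noteq> a \<and> line G a (partner a) = {a, partner a} \<and>
     (\<forall>c\<in>G. c \<noteq> a \<longrightarrow> c \<noteq> partner a \<longrightarrow> card (line G a c) = 3)"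
    unfolding partner_def by (rule someI_ex) (use ex_partner[OF assms] in blast)
  then show "partner a \<in> G" "partner a \<noteq> a" "line G a (partner a) = {a, partner a}"
    "\<And>c. c \<in> G \<Longrightarrow> c \<noteq> a \<Longrightarrow> c \<noteq> partner a \<Longrightarrow> card (line G a c) = 3" by auto
qed

lemma partner_eqI:
  assumes "a \<in> G" "b \<in> G" "b \<noteq> a" "card (line G a b) \<noteq> 3"
  shows "partner a = b"
  using partner(4)[OF assms(1), of b] assms by blast

lemma line_swap: "line G b a = line G a b"
  by (auto simp: line_def det3_swap12[of b a])

lemma partner_partner:
  assumes "a \<in> G" shows "partner (partner a) = a"
  using partner[OF assms] assms line_swap[of "partner a" a] by (intro partner_eqI) simp_all

lemma on_secant:
  assumes "a \<in> G" "i \<in> G" "det3 a i (partner i) = 0"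
  shows "a = i \<or> a = partner i"
proof -
  have "a \<in> line G i (partner i)" using assms by (simp add: line_def det3_rotate[of i "partner i" a])
  then show ?thesis using partner(3)[OF assms(2)] by simp
qed

text \<open>
  Counts the points whose two-point secant passes through \<open>R\<close>, that is, each such secant twice.
\<close>

definition secants :: "'a vec3 \<Rightarrow> nat" where
  "secants R = card {i \<in> G. det3 R i (partner i) = 0}"

text \<open>All fibres of the pencil at \<open>p\<close> have one or two elements, so every line
  through \<open>p\<close> meets \<open>G\<close> again. The point \<open>R\<close> is included in
  the domain of the coordinate so that \<open>f R\<close> names the line \<open>p R\<close>.\<close>

lemma not_tangent:
  assumes R: "\<And>p. p \<in> G \<Longrightarrow> indep R p" and "p \<in> G"
  obtains x where "x \<in> G" "x \<noteq> p" "det3 R p x = 0"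
proof -
  have ind: "indep p u" if "u \<in> insert R (G - {p})" for u
    using that R[OF \<open>p \<in> G\<close>] indep_G[OF \<open>p \<in> G\<close>, of u] indep_sym by auto
  obtain f :: "'a vec3 \<Rightarrow> 'a option"
    where "\<forall>x\<in>insert R (G - {p}). \<forall>y\<in>insert R (G - {p}). f x = f y \<longleftrightarrow> det3 p x y = 0"
    by (rule exE[OF pencil_coordinate[OF ind]])
  then have f: "f x = f y \<longleftrightarrow> det3 p x y = 0" if "x \<in> insert R (G - {p})" "y \<in> insert R (G - {p})" for x y
    using that by blast
  have f': "f x = f y \<longleftrightarrow> det3 p x y = 0" if "x \<in> G - {p}" "y \<in> G - {p}" for x y
    using f that by simp
  obtain s\<^sub>0 where s\<^sub>0: "card {x \<in> G - {p}. f x = s\<^sub>0} = 1"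
    "\<forall>s. s \<noteq> s\<^sub>0 \<longrightarrow> card {x \<in> G - {p}. f x = s} = 2"
    by (rule card_fibre[OF \<open>p \<in> G\<close> f'])
  have "card {x \<in> G - {p}. f x = f R} \<noteq> 0" using s\<^sub>0 by (cases "f R = s\<^sub>0") auto
  then have "{x \<in> G - {p}. f x = f R} \<noteq> {}" by (metis card.empty)
  then obtain x where x: "x \<in> G - {p}" "f x = f R" by blast
  then have "det3 p x R = 0" using f[of x R] by simp
  then show ?thesis using that[of x] x det3_rotate[of p x R] by simp
qed

text \<open>A line through \<open>R\<close> that meets \<open>G\<close> carries two or three points
  of it. With m lines of the first kind and m' of the second, 2 m + 3 m' = 2 q + 2; thus m' is even
  and m is congruent to q + 1 modulo 3.\<close>

lemma secants_external:
  assumes R: "\<And>p. p \<in> G \<Longrightarrow> indep R p"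
  obtains m where "secants R = 2 * m" "m mod 3 = (CARD('a) + 1) mod 3"
proof -
  obtain f :: "'a vec3 \<Rightarrow> 'a option"
    where "\<forall>x\<in>G. \<forall>y\<in>G. f x = f y \<longleftrightarrow> det3 R x y = 0"
    by (rule exE[OF pencil_coordinate[OF R]])
  then have f: "f x = f y \<longleftrightarrow> det3 R x y = 0" if "x \<in> G" "y \<in> G" for x y
    using that by blast
  define F where "F s = {x \<in> G. f x = s}" for s
  \<comment> \<open>Two points with the same slope from \<open>R\<close> span a line through
    \<open>R\<close>, so the fibre is a full secant.\<close>
  have F: "F (f p) = line G p x" if "p \<in> G" "x \<in> G" "x \<noteq> p" "f p = f x" for p x
  proof -
    have "det3 R p x = 0" using f that by blast
    then have "det3 R p y = 0 \<longleftrightarrow> det3 p x y = 0" for y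
      using det3_line_eq_iff[OF R[OF that(1)] indep_G] that by blast
    moreover have "F (f p) = {y \<in> G. det3 R p y = 0}" using f[OF that(1)] by (auto simp: F_def eq_commute[of _ "f p"])
    ultimately show ?thesis by (simp add: line_def)
  qed
  have F_other: "\<exists>x\<in>G. x \<noteq> p \<and> f p = f x" if p: "p \<in> G" for p
  proof -
    obtain x where "x \<in> G" "x \<noteq> p" "det3 R p x = 0" by (rule not_tangent[OF R p])
    then show ?thesis using f[OF p, of x] by blast
  qed
  \<comment> \<open>The fibre has two points exactly if the line from \<open>R\<close> to
    \<open>p\<close> is the two-point secant of \<open>p\<close>.\<close>
  have F3: "card (F (f p)) = (if det3 R p (partner p) = 0 then 2 else 3)" if p: "p \<in> G" for p
  proof (cases "det3 R p (partner p) = 0")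
    case True
    then have "F (f p) = line G p (partner p)" using F f partner[OF p] p by metis
    then show ?thesis using True partner[OF p] by simp
  next
    case False
    obtain x where x: "x \<in> G" "x \<noteq> p" "f p = f x" using F_other[OF p] by blast
    then have "x \<noteq> partner p" using False f p by blast
    then show ?thesis using F[OF p x] partner(4)[OF p x(1,2)] False by simp
  qed
  define S2 where "S2 = f ` {p \<in> G. det3 R p (partner p) = 0}"
  define S3 where "S3 = f ` {p \<in> G. det3 R p (partner p) \<noteq> 0}"
  have S2: "card (F s) = 2" if "s \<in> S2" for s using that F3 by (auto simp: S2_def)
  have S3: "card (F s) = 3" if "s \<in> S3" for s using that F3 by (auto simp: S3_def)
  have "card {p \<in> G. det3 R p (partner p) = 0} = (\<Sum>s\<in>S2. card {x \<in> {p \<in> G. det3 R p (partner p) = 0}. f x = s})"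
    using sum.group[of "{p \<in> G. det3 R p (partner p) = 0}" S2 f "\<lambda>_. 1::nat"] finite_G
    by (simp add: S2_def)
  also have "\<dots> = (\<Sum>s\<in>S2. 2)"
  proof (rule sum.cong[OF refl])
    fix s assume s: "s \<in> S2"
    have "det3 R x (partner x) = 0" if "x \<in> F s" for x
      using S2[OF s] F3[of x] that by (auto simp: F_def split: if_splits)
    then have "{x \<in> {p \<in> G. det3 R p (partner p) = 0}. f x = s} = F s" by (auto simp: F_def)
    then show "card {x \<in> {p \<in> G. det3 R p (partner p) = 0}. f x = s} = 2" using S2[OF s] by simp
  qed
  finally have b: "secants R = 2 * card S2" by (simp add: secants_def)
  have "card {p \<in> G. det3 R p (partner p) \<noteq> 0} = (\<Sum>s\<in>S3. card {x \<in> {p \<in> G. det3 R p (partner p) \<noteq> 0}. f x = s})"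
    using sum.group[of "{p \<in> G. det3 R p (partner p) \<noteq> 0}" S3 f "\<lambda>_. 1::nat"] finite_G
    by (simp add: S3_def)
  also have "\<dots> = (\<Sum>s\<in>S3. 3)"
  proof (rule sum.cong[OF refl])
    fix s assume s: "s \<in> S3"
    have "det3 R x (partner x) \<noteq> 0" if "x \<in> F s" for x
      using S3[OF s] F3[of x] that by (auto simp: F_def split: if_splits)
    then have "{x \<in> {p \<in> G. det3 R p (partner p) \<noteq> 0}. f x = s} = F s" by (auto simp: F_def)
    then show "card {x \<in> {p \<in> G. det3 R p (partner p) \<noteq> 0}. f x = s} = 3" using S3[OF s] by simp
  qed
  finally have c: "card {p \<in> G. det3 R p (partner p) \<noteq> 0} = 3 * card S3" by simp
  have "G = {p \<in> G. det3 R p (partner p) = 0} \<union> {p \<in> G. det3 R p (partner p) \<noteq> 0}" by blast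
  then have "card G = card ({p \<in> G. det3 R p (partner p) = 0} \<union> {p \<in> G. det3 R p (partner p) \<noteq> 0})"
    by (rule arg_cong)
  also have "\<dots> = secants R + card {p \<in> G. det3 R p (partner p) \<noteq> 0}"
    unfolding secants_def using finite_G by (intro card_Un_disjoint) auto
  finally have "card G = secants R + card {p \<in> G. det3 R p (partner p) \<noteq> 0}" .
  then have e: "2 * (CARD('a) + 1) = 2 * card S2 + 3 * card S3" using b c card_G by simp
  then have "even (2 * card S2 + 3 * card S3)" by (metis dvd_triv_left)
  then have "even (card S3)" by simp
  then obtain j where "card S3 = 2 * j" ..
  then have "CARD('a) + 1 = card S2 + 3 * j" using e by simp
  then have "card S2 mod 3 = (CARD('a) + 1) mod 3" by simp
  with b show ?thesis by (rule that)
qed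

text \<open>A parametrisation of the points of the line \<open>a b\<close>. The sign makes the
  parameter of the point in which the secant of \<open>i\<close> meets this line equal to the slope
  of the values of \<open>det3 _ i (partner i)\<close> at \<open>a\<close> and
  \<open>b\<close>.\<close>

fun line_point :: "'a vec3 \<Rightarrow> 'a vec3 \<Rightarrow> 'a option \<Rightarrow> 'a vec3" where
  "line_point a b None = b"
| "line_point a b (Some c) = a + scale3 (- c) b"

text \<open>The second assumption says that the secant of \<open>i\<close> is not the line
  \<open>a b\<close> itself. It then meets that line in exactly one of its q + 1 points, so every
  \<open>i\<close> is counted once.\<close>

lemma sum_secants_on_line:
  assumes "H \<subseteq> G" "\<And>i. i \<in> H \<Longrightarrow> det3 a i (partner i) = 0 \<Longrightarrow> det3 b i (partner i) \<noteq> 0"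
  shows "(\<Sum>s\<in>UNIV. card {i \<in> H. det3 (line_point a b s) i (partner i) = 0}) = card H"
proof -
  let ?f = "\<lambda>i. slope (det3 a i (partner i)) (det3 b i (partner i))"
  have f: "?f i = s \<longleftrightarrow> det3 (line_point a b s) i (partner i) = 0" if "i \<in> H" for i s
  proof (cases s)
    case None then show ?thesis by (simp add: slope_def)
  next
    case (Some c)
    then show ?thesis using assms(2)[OF that]
      by (cases "det3 b i (partner i) = 0") (auto simp: slope_def det3_add det3_scale field_simps)
  qed
  have eq: "{i \<in> H. det3 (line_point a b s) i (partner i) = 0} = {i \<in> H. ?f i = s}" for s
    by (intro Collect_cong conj_cong refl) (simp only: f)
  have "finite H" using assms(1) finite_G by (rule finite_subset)
  then show ?thesis unfolding eq by (rule card_eq_sum_fibres[symmetric])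
qed

text \<open>A two-point secant contains no points of \<open>G\<close> besides \<open>a\<close> and
  its partner, and nonzero coefficients keep the combination away from these two.\<close>

lemma external_on_secant:
  assumes "a \<in> G" "\<alpha> \<noteq> 0" "\<beta> \<noteq> 0" "p \<in> G"
  shows "indep (scale3 \<alpha> a + scale3 \<beta> (partner a)) p" (is "indep ?R p")
proof -
  let ?b = "partner a"
  obtain c where c: "det3 a ?b c \<noteq> 0"
    using indep_G[of a ?b] partner[OF assms(1)] assms(1) by (auto simp: indep_def)
  consider "p = a" | "p = ?b" | "p \<noteq> a" "p \<noteq> ?b" by blast
  then show ?thesis
  proof cases
    case 1
    have "det3 ?R a c \<noteq> 0" using assms c by (simp add: det3_add det3_scale det3_swap12[of ?b a])
    then show ?thesis using 1 by (auto simp: indep_def)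
  next
    case 2
    have "det3 ?R ?b c \<noteq> 0" using assms c by (simp add: det3_add det3_scale)
    then show ?thesis unfolding 2 by (auto simp: indep_def)
  next
    case 3
    then have "det3 a ?b p \<noteq> 0" using partner(3)[OF assms(1)] assms(4) by (auto simp: line_def)
    then have "det3 ?b p a \<noteq> 0" by (simp only: det3_rotate[of ?b p a] not_False_eq_True)
    then have "det3 ?R p a \<noteq> 0" using assms by (simp add: det3_add det3_scale)
    then show ?thesis by (auto simp: indep_def)
  qed
qed

text \<open>The two-point secants other than \<open>a b\<close> are q in number, and each meets the
  line \<open>a b\<close> in one of the q - 1 points different from \<open>a\<close> and
  \<open>b\<close>. Each of these points lies on a number of them that is congruent to q modulo 3,
  by \<open>secants_external\<close>.\<close>

lemma three_dvd_CARD: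
  assumes "CARD('a) > 2"
  shows "CARD('a) mod 3 = 0"
proof -
  let ?q = "CARD('a)"
  have "G \<noteq> {}" using card_G by auto
  then obtain a where a: "a \<in> G" by blast
  define b where "b = partner a"
  note b = partner[OF a, folded b_def]
  have pb: "partner b = a" using partner_partner[OF a] by (simp add: b_def)
  define H where "H = G - {a, b}"
  define R where "R c = a + scale3 (- c) b" for c
  \<comment> \<open>A point of \<open>G\<close> on the secant of \<open>i\<close> is
    \<open>i\<close> or its partner, so no secant besides \<open>a b\<close> passes through
    \<open>a\<close> or \<open>b\<close>.\<close>
  have off: "det3 a i (partner i) \<noteq> 0" "det3 b i (partner i) \<noteq> 0" if "i \<in> H" for i
  proof -
    have i: "i \<in> G" "i \<noteq> a" "i \<noteq> b" using that by (auto simp: H_def)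
    show "det3 a i (partner i) \<noteq> 0"
    proof
      assume "det3 a i (partner i) = 0"
      then have "a = partner i" using on_secant[OF a i(1)] i by blast
      then have "b = i" using partner_partner[OF i(1)] by (simp add: b_def)
      then show False using i by simp
    qed
    show "det3 b i (partner i) \<noteq> 0"
    proof
      assume "det3 b i (partner i) = 0"
      then have "b = partner i" using on_secant[OF b(1) i(1)] i by blast
      then have "a = i" using partner_partner[OF i(1)] pb by simp
      then show False using i by simp
    qed
  qed
  \<comment> \<open>\<open>e\<close> is the number of two-point secants through the point other than
    \<open>a b\<close>; omitting that one turns the residue q + 1 into q.\<close>
  have ext: "\<exists>e. secants (R c) = 2 * e + 2 \<and> e mod 3 = ?q mod 3" if "c \<noteq> 0" for c
  proof -
    have "indep (R c) p" if "p \<in> G" for p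
      using external_on_secant[OF a, of 1 "- c" p] that \<open>c \<noteq> 0\<close> by (simp add: R_def b_def)
    then obtain m where m: "secants (R c) = 2 * m" "m mod 3 = (?q + 1) mod 3"
      by (rule secants_external)
    have "a \<in> {i \<in> G. det3 (R c) i (partner i) = 0}"
      using a by (simp add: R_def det3_add det3_scale flip: b_def)
    then have "secants (R c) \<noteq> 0" using finite_G by (auto simp: secants_def)
    then obtain e where e: "m = Suc e" using m by (cases m) auto
    then have "e mod 3 = ?q mod 3" using m(2) by (simp add: mod_Suc split: if_splits)
    then show ?thesis using m e by auto
  qed
  define e where "e c = (SOME e. secants (R c) = 2 * e + 2 \<and> e mod 3 = ?q mod 3)" for c
  have e: "secants (R c) = 2 * e c + 2" "e c mod 3 = ?q mod 3" if "c \<noteq> 0" for c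
    using someI_ex[OF ext[OF that]] by (auto simp: e_def)
  have cardH: "card {i \<in> H. det3 (R c) i (partner i) = 0} = 2 * e c" if "c \<noteq> 0" for c
  proof -
    have "det3 (R c) a (partner a) = 0" "det3 (R c) b (partner b) = 0"
      by (simp_all add: R_def det3_add det3_scale pb flip: b_def)
    then have "{i \<in> G. det3 (R c) i (partner i) = 0} = insert a (insert b {i \<in> H. det3 (R c) i (partner i) = 0})"
      using a b(1) by (auto simp: H_def)
    then have "secants (R c) = card (insert a (insert b {i \<in> H. det3 (R c) i (partner i) = 0}))"
      by (simp add: secants_def)
    also have "\<dots> = card {i \<in> H. det3 (R c) i (partner i) = 0} + 2"
      using finite_G b(2) by (simp add: H_def)
    finally show ?thesis using e[OF that] by simp
  qed
  have card_H: "card H = 2 * ?q"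
    using card_G a b(1,2) by (simp add: H_def card_Diff_subset)
  have none: "{i \<in> H. det3 a i (partner i) = 0} = {}" "{i \<in> H. det3 b i (partner i) = 0} = {}"
    using off by blast+
  \<comment> \<open>The points of \<open>H\<close> are counted along the line \<open>a b\<close>.
    The parameters \<open>None\<close> and \<open>Some 0\<close> stand for \<open>b\<close> and
    \<open>a\<close> and contribute nothing.\<close>
  have "2 * ?q = (\<Sum>s\<in>UNIV. card {i \<in> H. det3 (line_point a b s) i (partner i) = 0})"
    unfolding card_H[symmetric] by (rule sum_secants_on_line[symmetric]) (use off in \<open>auto simp: H_def\<close>)
  also have "\<dots> = card {i \<in> H. det3 b i (partner i) = 0} + (\<Sum>c\<in>UNIV. card {i \<in> H. det3 (R c) i (partner i) = 0})"
    by (simp add: UNIV_option_conv sum.reindex R_def)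
  also have "\<dots> = (\<Sum>c\<in>UNIV. card {i \<in> H. det3 (R c) i (partner i) = 0})"
    by (simp only: none card.empty)
  also have "\<dots> = card {i \<in> H. det3 (R 0) i (partner i) = 0} + (\<Sum>c\<in>UNIV - {0}. card {i \<in> H. det3 (R c) i (partner i) = 0})"
    by (rule sum.remove) auto
  also have "R 0 = a" by (simp add: R_def)
  also have "(\<Sum>c\<in>UNIV - {0}. card {i \<in> H. det3 (R c) i (partner i) = 0}) = (\<Sum>c\<in>UNIV - {0}. 2 * e c)"
    by (intro sum.cong refl cardH) simp
  finally have "?q = (\<Sum>c\<in>UNIV - {0}. e c)"
    by (simp only: none card.empty add_0 sum_distrib_left[symmetric])
  also have "\<dots> = (\<Sum>c\<in>UNIV - {0}. 3 * (e c div 3) + ?q mod 3)"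
    by (intro sum.cong refl) (metis DiffD2 e(2) insertI1 mult_div_mod_eq)
  also have "\<dots> = 3 * (\<Sum>c\<in>UNIV - {0}. e c div 3) + (?q - 1) * (?q mod 3)"
    by (simp add: sum.distrib sum_distrib_left card_Diff_singleton)
  finally have q: "?q = 3 * (\<Sum>c\<in>UNIV - {0}. e c div 3) + (?q - 1) * (?q mod 3)" .
  have "?q mod 3 \<noteq> 1"
  proof
    assume "?q mod 3 = 1"
    then have "3 * (\<Sum>c\<in>UNIV - {0}. e c div 3) + (?q - 1) = ?q" using q by simp
    then have "3 * (\<Sum>c\<in>UNIV - {0}. e c div 3) = 1" using assms by linarith
    then show False by simp
  qed
  \<comment> \<open>The residue 2 is consistent modulo 3 and is excluded by size: each of the q - 1
    summands would be at least 2, while their sum is q > 2.\<close>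
  moreover have "?q mod 3 \<noteq> 2"
  proof
    assume "?q mod 3 = 2"
    then have "(?q - 1) * 2 \<le> ?q" using q by simp
    then show False using assms by simp
  qed
  ultimately show ?thesis by (metis One_nat_def Suc_1 less_2_cases mod_less_divisor less_Suc_eq numeral_3_eq_3 zero_less_numeral)
qed

text \<open>The two-point secants cover the plane. Off \<open>G\<close> their number through
  \<open>R\<close> is congruent to 1 modulo 3 because 3 divides q, hence nonzero; at a point
  \<open>p\<close> of \<open>G\<close> there is the secant of \<open>p\<close>. The count is 2 since
  both points of the secant are counted.\<close>

lemma secants_ge_2:
  assumes "CARD('a) > 2"
  shows "secants R \<ge> 2"
proof (cases "\<forall>p\<in>G. indep R p")
  case True
  obtain m where m: "secants R = 2 * m" "m mod 3 = (CARD('a) + 1) mod 3"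
    using secants_external True by metis
  have "m mod 3 = 1" using m(2) three_dvd_CARD[OF assms] by (simp add: mod_Suc)
  then have "m \<noteq> 0" by auto
  then show ?thesis using m(1) by simp
next
  case False
  then obtain p where p: "p \<in> G" "\<not> indep R p" by blast
  have "{p, partner p} \<subseteq> {i \<in> G. det3 R i (partner i) = 0}"
    using p partner(1)[OF p(1)] partner_partner[OF p(1)]
    by (auto simp: indep_def det3_swap[of R "partner p" p])
  then have "card {p, partner p} \<le> secants R"
    unfolding secants_def using finite_G by (intro card_mono) auto
  then show ?thesis using partner(2)[OF p(1)] by simp
qed

text \<open>If the line \<open>x y\<close> has three points of \<open>G\<close>, it is no two-point
  secant, so the values of \<open>secants\<close> at its q + 1 points add up to 2 q + 2. As each
  value is at least 2, all are equal to 2, contrary to the value at \<open>R\<close>.\<close>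

lemma card_line_le_2:
  assumes "CARD('a) > 2" and "secants R \<ge> 4" and xy: "x \<in> G" "y \<in> G" "x \<noteq> y" and "det3 x y R = 0"
    and R_ext: "\<And>p. p \<in> G \<Longrightarrow> indep R p"
  shows "card (line G x y) \<le> 2"
proof (rule ccontr)
  assume not2: "\<not> card (line G x y) \<le> 2"
  have "det3 y i (partner i) \<noteq> 0" if i: "i \<in> G" "det3 x i (partner i) = 0" for i
  proof
    assume "det3 y i (partner i) = 0"
    then have "{x, y} = {i, partner i}"
      using on_secant[OF xy(1) i] on_secant[OF xy(2) i(1)] xy(3) by blast
    then have "line G x y = line G i (partner i)"
      using line_swap by (metis doubleton_eq_iff)
    then show False using partner(2,3)[OF i(1)] not2 by simp
  qed
  then have sum: "(\<Sum>s\<in>UNIV. secants (line_point x y s)) = 2 * CARD('a) + 2"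
    using sum_secants_on_line[of G x y] card_G by (simp add: secants_def)
  obtain \<alpha> \<beta> where R: "R = scale3 \<alpha> x + scale3 \<beta> y"
    using indep_combination[OF indep_G[OF xy] assms(6)] by metis
  have "\<alpha> \<noteq> 0" using R_ext[OF xy(2)] by (auto simp: R indep_def det3_add det3_scale)
  \<comment> \<open>The parameter of \<open>R\<close> on the line \<open>x y\<close>; it is finite
    because \<open>R\<close> is not a multiple of \<open>y\<close>.\<close>
  define s\<^sub>0 where "s\<^sub>0 = Some (- \<beta> / \<alpha>)"
  have "R = scale3 \<alpha> (line_point x y s\<^sub>0)"
    using \<open>\<alpha> \<noteq> 0\<close> by (simp add: R s\<^sub>0_def scale3_add)
  then have "secants (line_point x y s\<^sub>0) = secants R"
    using \<open>\<alpha> \<noteq> 0\<close> by (simp add: secants_def det3_scale)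
  then have "secants (line_point x y s\<^sub>0) > 2" using assms(2) by simp
  then have "(\<Sum>s\<in>(UNIV :: 'a option set). 2) < (\<Sum>s\<in>UNIV. secants (line_point x y s))"
    using secants_ge_2[OF assms(1)] by (intro sum_strict_mono_ex1) auto
  then show False using sum by (simp add: card_UNIV_option)
qed

text \<open>The point to add is the intersection of two of the two-point secants. By
  \<open>card_line_le_2\<close> every line through it has at most two points of \<open>G\<close>, so
  there is room for a third one.\<close>

lemma extendable:
  assumes "CARD('a) > 2"
  shows "\<exists>R. maximal_arc (insert R G)"
proof -
  have "G \<noteq> {}" using card_G by auto
  then obtain a where a: "a \<in> G" by blast
  define b where "b = partner a"
  note b = partner[OF a, folded b_def]
  have "\<not> G \<subseteq> {a, b}"
    using card_G card_mono[of "{a, b}" G] assms b(2) by auto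
  then obtain c where c: "c \<in> G" "c \<noteq> a" "c \<noteq> b" by blast
  define d where "d = partner c"
  note d = partner[OF c(1), folded d_def]
  have pb: "partner b = a" "partner d = c"
    using partner_partner[OF a] partner_partner[OF c(1)] by (simp_all add: b_def d_def)
  have da: "d \<noteq> a" "d \<noteq> b" using pb c b_def by auto
  have nz: "det3 a c d \<noteq> 0" "det3 b c d \<noteq> 0"
    using on_secant[OF a c(1)] on_secant[OF b(1) c(1)] c da unfolding d_def by blast+
  \<comment> \<open>The point of the line \<open>a b\<close> at which the form
    \<open>det3 _ c d\<close> vanishes.\<close>
  define R where "R = scale3 (det3 b c d) a + scale3 (- det3 a c d) b"
  have ext: "indep R p" if "p \<in> G" for p
    unfolding R_def b_def using nz that by (intro external_on_secant a) (simp_all add: b_def)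
  have Rab: "det3 R a b = 0" "det3 R b a = 0" by (simp_all add: R_def det3_add det3_scale)
  have Rcd: "det3 R c d = 0" "det3 R d c = 0"
    by (simp_all add: R_def det3_add det3_scale det3_swap[of _ d c])
  have "{a, b, c, d} \<subseteq> {i \<in> G. det3 R i (partner i) = 0}"
    using a b(1) c(1) d(1) Rab Rcd pb by (auto simp flip: b_def d_def)
  then have "card {a, b, c, d} \<le> secants R"
    unfolding secants_def using finite_G by (intro card_mono) auto
  moreover have "card {a, b, c, d} = 4" using b(2) c d(2) da by auto
  ultimately have R4: "secants R \<ge> 4" by simp
  have RG: "R \<notin> G" using ext indep_irrefl by blast
  have line_R: "card {y \<in> G. det3 R x y = 0} \<le> 2" if x: "x \<in> G" for x
  proof -
    obtain y where y: "y \<in> G" "y \<noteq> x" "det3 R x y = 0" using not_tangent[OF ext x] by blast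
    have "{y \<in> G. det3 R x y = 0} = line G x y"
      unfolding line_def using det3_line_eq_iff[OF ext[OF x] indep_G y(3)] x y by blast
    moreover have "det3 x y R = 0" using y(3) by (simp add: det3_rotate[of x y R])
    ultimately show ?thesis using card_line_le_2[OF assms R4 x y(1) _ _ ext] y(2) by simp
  qed
  have "arc3 (insert R G)"
    unfolding arc3_def
  proof (intro conjI ballI impI)
    show "finite (insert R G)" using finite_G by simp
    fix x y assume xy: "x \<in> insert R G" "y \<in> insert R G" "x \<noteq> y"
    show "indep x y" using xy ext indep_G indep_sym by blast
    have R3: "card (insert R {y \<in> G. det3 R x y = 0}) \<le> 3" if "x \<in> G" for x
      using line_R[OF that] finite_G RG by simp
    consider "x = R" "y \<in> G" | "y = R" "x \<in> G" | "x \<in> G" "y \<in> G" using xy by blast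
    then show "card (line (insert R G) x y) \<le> 3"
    proof cases
      case 1
      then have "line (insert R G) x y = insert R {z \<in> G. det3 R y z = 0}" by (auto simp: line_def)
      then show ?thesis using R3[OF 1(2)] by simp
    next
      case 2
      then have "line (insert R G) x y = insert R {z \<in> G. det3 R x z = 0}"
        by (auto simp: line_def det3_swap12[of x R])
      then show ?thesis using R3[OF 2(2)] by simp
    next
      case 3
      show ?thesis
      proof (cases "det3 x y R = 0")
        case True
        then have "line (insert R G) x y = insert R (line G x y)" by (auto simp: line_def)
        then show ?thesis
          using card_line_le_2[OF assms R4 3 xy(3) True ext] RG finite_G by (simp add: line_def)
      next
        case False
        then have "line (insert R G) x y = line G x y" by (auto simp: line_def)
        then show ?thesis using arc 3 xy(3) by (simp add: arc3_def)
      qed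
    qed
  qed
  moreover have "card (insert R G) = 2 * CARD('a) + 3" using RG finite_G card_G by simp
  ultimately show ?thesis by (auto intro!: exI[of _ R] maximal_arc.intro)
qed

end

text \<open>Subsets of arcs are arcs, so a larger arc contains one with 2 q + 2 points. That one
  extends to 2 q + 3 points, which forces q to be at most 3.\<close>

theorem arc3_card_le:
  fixes G :: "'a::{field,finite} vec3 set"
  assumes "arc3 G" "CARD('a) > 3"
  shows "card G \<le> 2 * CARD('a) + 1"
proof (rule ccontr)
  assume "\<not> ?thesis"
  then have "2 * CARD('a) + 2 \<le> card G" by simp
  then obtain H where H: "H \<subseteq> G" "card H = 2 * CARD('a) + 2"
    by (rule obtain_subset_with_card_n)
  interpret deficient_arc H
    using arc3_subset[OF assms(1) H(1)] H(2) by unfold_locales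
  obtain R where "maximal_arc (insert R H)" using extendable assms(2) by auto
  then show False using maximal_arc.CARD_le_3 assms(2) by fastforce
qed

section \<open>Words with prescribed zeros and duality\<close>

definition supp_space :: "nat set \<Rightarrow> (nat \<Rightarrow> 'a::field) set" where
  "supp_space J = {x. \<forall>i. i \<notin> J \<longrightarrow> x i = 0}"

text \<open>The shortened code, with the zero coordinates kept so that all words stay in the same
  space.\<close>

definition vanishing :: "(nat \<Rightarrow> 'a::field) set \<Rightarrow> nat set \<Rightarrow> (nat \<Rightarrow> 'a) set" where
  "vanishing V J = {x \<in> V. \<forall>i\<in>J. x i = 0}"

lemma word_space_eq: "word_space n = supp_space {..<n}"
  by (auto simp: word_space_def supp_space_def)

lemma card_supp_space:
  assumes "finite J"
  shows "card (supp_space J :: (nat \<Rightarrow> 'a::{field,finite}) set) = CARD('a) ^ card J"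
    and "finite (supp_space J :: (nat \<Rightarrow> 'a) set)"
proof -
  have bij: "bij_betw (\<lambda>f i. if i \<in> J then f i else 0) (J \<rightarrow>\<^sub>E UNIV) (supp_space J :: (nat \<Rightarrow> 'a) set)"
    by (rule bij_betw_byWitness[where f' = "\<lambda>x. restrict x J"])
      (auto simp: supp_space_def fun_eq_iff PiE_def extensional_def)
  have fin: "finite (J \<rightarrow>\<^sub>E (UNIV :: 'a set))" using assms by (intro finite_PiE) auto
  then show "finite (supp_space J :: (nat \<Rightarrow> 'a) set)" using bij_betw_finite[OF bij] by simp
  show "card (supp_space J :: (nat \<Rightarrow> 'a) set) = CARD('a) ^ card J"
    using bij_betw_same_card[OF bij] assms by (simp add: card_PiE)
qed

lemma finite_code:
  fixes C :: "(nat \<Rightarrow> 'a::{field,finite}) set"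
  assumes "C \<subseteq> word_space n" shows "finite C"
  using assms card_supp_space(2)[of "{..<n}"] finite_subset unfolding word_space_eq by blast

text \<open>Coordinates with respect to a basis. This turns statements about dimensions into
  statements about cardinalities.\<close>

lemma card_subspace:
  fixes V :: "(nat \<Rightarrow> 'a::{field,finite}) set"
  assumes "words.subspace V" "finite V"
  shows "card V = CARD('a) ^ words.dim V"
proof -
  obtain B where B: "B \<subseteq> V" "words.independent B" "V \<subseteq> words.span B" "card B = words.dim V"
    using words.basis_exists by metis
  have fB: "finite B" using B(1) assms(2) by (rule finite_subset)
  have V: "V = words.span B" using B assms(1) words.span_minimal by blast
  define L where "L u = (\<Sum>b\<in>B. word_scale (u b) b)" for u
  have "bij_betw L (B \<rightarrow>\<^sub>E UNIV) V"
    unfolding bij_betw_def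
  proof
    show "inj_on L (B \<rightarrow>\<^sub>E UNIV)"
    proof (rule inj_onI)
      fix u v assume uv: "u \<in> B \<rightarrow>\<^sub>E UNIV" "v \<in> B \<rightarrow>\<^sub>E UNIV" "L u = L v"
      have "(\<Sum>b\<in>B. word_scale (u b - v b) b) = 0"
        using uv(3) by (simp add: L_def words.scale_left_diff_distrib sum_subtractf)
      then have "u b - v b = 0" if "b \<in> B" for b
        using words.independentD[OF B(2) fB subset_refl, of "\<lambda>b. u b - v b" b] that by blast
      then show "u = v" using uv by (intro PiE_ext[of u B _ v]) auto
    qed
    have "L ` (B \<rightarrow>\<^sub>E UNIV) = range L"
    proof -
      have "L u \<in> L ` (B \<rightarrow>\<^sub>E UNIV)" for u
        by (rule image_eqI[of _ _ "restrict u B"]) (simp_all add: L_def)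
      then show ?thesis by blast
    qed
    then show "L ` (B \<rightarrow>\<^sub>E UNIV) = V" unfolding V words.span_finite[OF fB] L_def by simp
  qed
  then have "card V = card (B \<rightarrow>\<^sub>E (UNIV :: 'a set))" by (rule bij_betw_same_card[symmetric])
  then show ?thesis using fB B(4) by (simp add: card_PiE)
qed

text \<open>Restriction to \<open>J\<close> is additive with kernel \<open>vanishing V J\<close> and
  takes its values in \<open>supp_space J\<close>.\<close>

lemma card_le_vanishing:
  fixes V :: "(nat \<Rightarrow> 'a::{field,finite}) set"
  assumes "words.subspace V" "finite V" "finite J"
  shows "card V \<le> CARD('a) ^ card J * card (vanishing V J)"
    and "card V = card ((\<lambda>x i. if i \<in> J then x i else 0) ` V) * card (vanishing V J)"
proof -
  let ?\<phi> = "\<lambda>(x :: nat \<Rightarrow> 'a) i. if i \<in> J then x i else 0"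
  have "card V = card (?\<phi> ` V) * card {x \<in> V. ?\<phi> x = 0}"
    using assms words.subspace_diff by (intro card_additive_image) (auto simp: fun_eq_iff)
  moreover have "{x \<in> V. ?\<phi> x = 0} = vanishing V J" by (auto simp: vanishing_def fun_eq_iff)
  ultimately show eq: "card V = card (?\<phi> ` V) * card (vanishing V J)" by simp
  have "card (?\<phi> ` V) \<le> card (supp_space J :: (nat \<Rightarrow> 'a) set)"
    using card_supp_space[OF assms(3)] by (intro card_mono) (auto simp: supp_space_def)
  then show "card V \<le> CARD('a) ^ card J * card (vanishing V J)"
    using eq card_supp_space(1)[OF assms(3), where 'a = 'a] by simp
qed

lemma subspace_vanishing: "words.subspace V \<Longrightarrow> words.subspace (vanishing V J)"
  by (auto simp: words.subspace_def vanishing_def word_scale_def)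

text \<open>A nonzero linear functional takes every value of the field, so its kernel has index
  q.\<close>

lemma card_kernel_functional:
  fixes W :: "(nat \<Rightarrow> 'a::{field,finite}) set" and \<phi> :: "(nat \<Rightarrow> 'a) \<Rightarrow> 'a"
  assumes "words.subspace W" "finite W"
    and hom: "\<And>x y. \<phi> (x - y) = \<phi> x - \<phi> y" and scale: "\<And>c x. \<phi> (word_scale c x) = c * \<phi> x"
    and "x \<in> W" "\<phi> x \<noteq> 0"
  shows "CARD('a) * card {x \<in> W. \<phi> x = 0} = card W"
proof -
  have "c \<in> \<phi> ` W" for c
  proof (rule image_eqI)
    show "c = \<phi> (word_scale (c / \<phi> x) x)" using assms by (simp add: scale)
    show "word_scale (c / \<phi> x) x \<in> W" using assms words.subspace_scale by blast
  qed
  then have "\<phi> ` W = UNIV" by auto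
  moreover have "card W = card (\<phi> ` W) * card {x \<in> W. \<phi> x = 0}"
    by (intro card_additive_image assms(2) words.subspace_diff[OF assms(1)] hom)
  ultimately show ?thesis by simp
qed

lemma CARD_field_ge_2: "CARD('a::{field,finite}) \<ge> 2"
proof -
  have "card {0, 1::'a} \<le> CARD('a)" by (intro card_mono) auto
  then show ?thesis by simp
qed

text \<open>Orthogonal pairs are counted in two ways. A nonzero \<open>x\<close> is orthogonal to a
  fraction 1/q of \<open>U\<close>, and a \<open>y\<close> outside the annihilator \<open>P\<close>
  to a fraction 1/q of \<open>V\<close>, whereas 0 and the elements of \<open>P\<close> are
  orthogonal to everything.\<close>

lemma card_annihilator:
  fixes V :: "(nat \<Rightarrow> 'a::{field,finite}) set"
  assumes "finite J" "words.subspace V" "V \<subseteq> supp_space J"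
  shows "card V * card {y \<in> supp_space J. \<forall>x\<in>V. (\<Sum>i\<in>J. x i * y i) = 0} = CARD('a) ^ card J"
proof -
  let ?q = "CARD('a)"
  define U where "U = (supp_space J :: (nat \<Rightarrow> 'a) set)"
  define dot where "dot x y = (\<Sum>i\<in>J. x i * y i)" for x y :: "nat \<Rightarrow> 'a"
  define P where "P = {y \<in> U. \<forall>x\<in>V. dot x y = 0}"
  have finU: "finite U" and card_U: "card U = ?q ^ card J"
    using card_supp_space[OF assms(1), where 'a = 'a] by (auto simp: U_def)
  have finV: "finite V" using assms(3) finU U_def finite_subset by auto
  have subU: "words.subspace U"
    by (auto simp: U_def words.subspace_def supp_space_def word_scale_def)
  have 0: "0 \<in> V" using words.subspace_0[OF assms(2)] .
  have x: "?q * card {y \<in> U. dot x y = 0} = (if x = 0 then ?q * card U else card U)" if "x \<in> V" for x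
  proof (cases "x = 0")
    case True then show ?thesis by (simp add: dot_def)
  next
    case False
    then obtain i where i: "x i \<noteq> 0" by (auto simp: fun_eq_iff)
    then have iJ: "i \<in> J" using that assms(3) by (auto simp: supp_space_def)
    define y where "y = (\<lambda>j. if j = i then 1 else (0::'a))"
    have "y \<in> U" using iJ by (auto simp: U_def supp_space_def y_def)
    moreover have "dot x y \<noteq> 0" using i iJ assms(1) by (simp add: dot_def y_def if_distrib cong: if_cong)
    ultimately have "?q * card {y \<in> U. dot x y = 0} = card U"
      by (intro card_kernel_functional[OF subU finU])
        (auto simp: dot_def word_scale_def algebra_simps sum_subtractf sum_distrib_left)
    then show ?thesis using False by simp
  qed
  have y: "?q * card {x \<in> V. dot x y = 0} = (if y \<in> P then ?q * card V else card V)" if yU: "y \<in> U" for y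
  proof (cases "y \<in> P")
    case True
    then have "{x \<in> V. dot x y = 0} = V" by (auto simp: P_def)
    then show ?thesis using True by simp
  next
    case False
    then obtain x where "x \<in> V" "dot x y \<noteq> 0" using yU by (auto simp: P_def)
    then have "?q * card {x \<in> V. dot x y = 0} = card V"
      by (intro card_kernel_functional[OF assms(2) finV])
        (auto simp: dot_def word_scale_def algebra_simps sum_subtractf sum_distrib_left)
    then show ?thesis using False by simp
  qed
  have "(\<Sum>x\<in>V. card {y \<in> U. dot x y = 0}) = (\<Sum>y\<in>U. card {x \<in> V. dot x y = 0})"
    using sum_multicount_gen[of U V "\<lambda>y x. dot x y = 0" "\<lambda>x. card {y \<in> U. dot x y = 0}"] finU finV by simp
  then have "(\<Sum>x\<in>V. ?q * card {y \<in> U. dot x y = 0}) = (\<Sum>y\<in>U. ?q * card {x \<in> V. dot x y = 0})"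
    by (simp flip: sum_distrib_left)
  moreover have "(\<Sum>x\<in>V. ?q * card {y \<in> U. dot x y = 0}) = ?q * card U + (card V - 1) * card U"
  proof -
    have "(\<Sum>x\<in>V. ?q * card {y \<in> U. dot x y = 0}) = (\<Sum>x\<in>V. if x = 0 then ?q * card U else card U)"
      by (intro sum.cong refl x)
    also have "\<dots> = ?q * card U + (\<Sum>x\<in>V - {0}. if x = 0 then ?q * card U else card U)"
      using sum.remove[OF finV 0, of "\<lambda>x. if x = 0 then ?q * card U else card U"] by simp
    also have "(\<Sum>x\<in>V - {0}. if x = 0 then ?q * card U else card U) = (\<Sum>x\<in>V - {0}. card U)"
      by (intro sum.cong) auto
    finally show ?thesis using 0 by (simp add: card_Diff_singleton)
  qed
  moreover have "(\<Sum>y\<in>U. ?q * card {x \<in> V. dot x y = 0}) = card P * (?q * card V) + (card U - card P) * card V"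
  proof -
    have PU: "P \<subseteq> U" "finite P" using finU by (auto simp: P_def)
    have "(\<Sum>y\<in>U. ?q * card {x \<in> V. dot x y = 0}) = (\<Sum>y\<in>U. if y \<in> P then ?q * card V else card V)"
      by (intro sum.cong refl y)
    also have "\<dots> = (\<Sum>y\<in>U - P. if y \<in> P then ?q * card V else card V) + (\<Sum>y\<in>P. if y \<in> P then ?q * card V else card V)"
      by (rule sum.subset_diff[OF PU(1) finU])
    also have "(\<Sum>y\<in>U - P. if y \<in> P then ?q * card V else card V) = (\<Sum>y\<in>U - P. card V)"
      by (intro sum.cong) auto
    finally show ?thesis using PU by (simp add: card_Diff_subset)
  qed
  ultimately have "?q * card U + (card V - 1) * card U = card P * (?q * card V) + (card U - card P) * card V"
    by simp
  moreover have "card P \<le> card U" using finU by (intro card_mono) (auto simp: P_def)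
  moreover have "card V \<ge> 1" using 0 finV by (auto simp: Suc_le_eq card_gt_0_iff)
  moreover note CARD_field_ge_2[where 'a = 'a]
  \<comment> \<open>The equation reduces to (q - 1) u = (q - 1) p v; the substitutions remove the
    truncated subtractions.\<close>
  moreover have "v * p = u" if "q * u + (v - 1) * u = p * (q * v) + (u - p) * v" "p \<le> u" "v \<ge> 1" "q \<ge> 2"
    for q u v p :: nat
  proof -
    define v' q' u' where "v' = v - 1" and "q' = q - 1" and "u' = u - p"
    then have eqs: "v = Suc v'" "q = Suc q'" "u = p + u'" "q' > 0" using that by auto
    have "q' * u = q' * (p * v)" using that(1) unfolding eqs by (simp add: algebra_simps)
    then show ?thesis using eqs(4) by (simp add: mult.commute)
  qed
  ultimately have "card V * card P = card U" by blast
  then show ?thesis using card_U by (simp add: P_def U_def dot_def)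
qed

section \<open>Weights, minimum distance and dual codes\<close>

lemma hamming_dist_eq: "hamming_dist x y = hamming_weight (x - y)"
  by (simp add: hamming_dist_def hamming_weight_def)

lemma min_distance_eq:
  assumes "words.subspace C"
  shows "min_distance C = Min (hamming_weight ` (C - {0}))"
proof -
  have "{hamming_dist x y | x y. x \<in> C \<and> y \<in> C \<and> x \<noteq> y} = hamming_weight ` (C - {0})"
  proof (intro equalityI subsetI)
    fix m assume "m \<in> {hamming_dist x y | x y. x \<in> C \<and> y \<in> C \<and> x \<noteq> y}"
    then obtain x y where "m = hamming_weight (x - y)" "x \<in> C" "y \<in> C" "x \<noteq> y"
      by (auto simp: hamming_dist_eq)
    then show "m \<in> hamming_weight ` (C - {0})"
      using words.subspace_diff[OF assms, of x y] by auto
  next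
    fix m assume "m \<in> hamming_weight ` (C - {0})"
    then obtain x where "m = hamming_dist x 0" "x \<in> C" "x \<noteq> 0" by (auto simp: hamming_dist_eq)
    then show "m \<in> {hamming_dist x y | x y. x \<in> C \<and> y \<in> C \<and> x \<noteq> y}"
      using words.subspace_0[OF assms] by blast
  qed
  then show ?thesis by (simp add: min_distance_def)
qed

lemma hamming_weight_eq:
  assumes "x \<in> word_space n"
  shows "hamming_weight x + card {i \<in> {..<n}. x i = 0} = n"
proof -
  have "{i. x i \<noteq> 0} = {i \<in> {..<n}. x i \<noteq> 0}"
    using assms by (auto simp: word_space_def not_less[symmetric])
  moreover have "card ({i \<in> {..<n}. x i \<noteq> 0} \<union> {i \<in> {..<n}. x i = 0})
      = card {i \<in> {..<n}. x i \<noteq> 0} + card {i \<in> {..<n}. x i = 0}"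
    by (rule card_Un_disjoint) auto
  moreover have "{i \<in> {..<n}. x i \<noteq> 0} \<union> {i \<in> {..<n}. x i = 0} = {..<n}" by auto
  ultimately show ?thesis by (simp add: hamming_weight_def)
qed

context
  fixes C :: "(nat \<Rightarrow> 'a::{field,finite}) set" and n k d :: nat
  assumes C: "linear_code n k d C"
begin

lemma linear_codeD:
  shows "C \<subseteq> word_space n" "words.subspace C" "finite C" "card C = CARD('a) ^ k" "1 \<le> k"
  using C finite_code[of C n] card_subspace[of C] by (auto simp: linear_code_def)

lemma linear_code_ex_nonzero: "C - {0} \<noteq> {}"
proof
  assume "C - {0} = {}"
  then have "card C \<le> card {0::nat \<Rightarrow> 'a}" by (intro card_mono) auto
  moreover have "CARD('a) ^ 1 \<le> card C"
    unfolding linear_codeD(4) using linear_codeD(5) by (intro power_increasing) simp_all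
  ultimately show False using CARD_field_ge_2[where 'a = 'a] by simp
qed

lemma linear_code_distance_eq: "d = Min (hamming_weight ` (C - {0}))"
  using C min_distance_eq by (auto simp: linear_code_def)

lemma linear_code_weight_ge:
  assumes "c \<in> C" "c \<noteq> 0" shows "d \<le> hamming_weight c"
  unfolding linear_code_distance_eq using linear_codeD(3) assms by (intro Min_le) auto

lemma linear_code_ex_min_weight:
  obtains c where "c \<in> C" "c \<noteq> 0" "hamming_weight c = d"
proof -
  have "d \<in> hamming_weight ` (C - {0})"
    unfolding linear_code_distance_eq using linear_codeD(3) linear_code_ex_nonzero by (intro Min_in) auto
  then show ?thesis using that by auto
qed

end

lemma linear_codeI:
  fixes C :: "(nat \<Rightarrow> 'a::{field,finite}) set"
  assumes "C \<subseteq> word_space n" "words.subspace C" "card C = CARD('a) ^ k" "1 \<le> k"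
    and "\<And>x. x \<in> C \<Longrightarrow> x \<noteq> 0 \<Longrightarrow> d \<le> hamming_weight x"
    and "c \<in> C" "c \<noteq> 0" "hamming_weight c \<le> d"
  shows "linear_code n k d C"
proof -
  have fin: "finite C" using assms(1) by (rule finite_code)
  have "CARD('a) ^ words.dim C = CARD('a) ^ k" using card_subspace[OF assms(2) fin] assms(3) by simp
  then have "words.dim C = k" using CARD_field_ge_2[where 'a = 'a] by (simp add: power_inject_exp)
  moreover have "min_distance C = d"
    unfolding min_distance_eq[OF assms(2)]
  proof (rule Min_eqI)
    show "finite (hamming_weight ` (C - {0}))" using fin by simp
    show "d \<le> m" if "m \<in> hamming_weight ` (C - {0})" for m using that assms(5) by auto
    have "hamming_weight c = d" using assms(5)[OF assms(6,7)] assms(8) by simp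
    then show "d \<in> hamming_weight ` (C - {0})" using assms(6,7) by auto
  qed
  ultimately show ?thesis using assms by (simp add: linear_code_def)
qed

lemma subspace_dual_code: "words.subspace (dual_code n C)"
  by (auto simp: words.subspace_def dual_code_def word_space_def word_scale_def
      algebra_simps sum.distrib mult.left_commute simp flip: sum_distrib_left)

lemma card_dual_code:
  fixes C :: "(nat \<Rightarrow> 'a::{field,finite}) set"
  assumes "words.subspace C" "C \<subseteq> word_space n"
  shows "card C * card (dual_code n C) = CARD('a) ^ n"
  using card_annihilator[of "{..<n}" C] assms by (simp add: dual_code_def word_space_eq)

text \<open>\<open>C\<close> lies in its bidual, and applying \<open>card_dual_code\<close> to
  \<open>C\<close> and to its dual shows that both have the same size.\<close>

lemma dual_dual_code:
  fixes C :: "(nat \<Rightarrow> 'a::{field,finite}) set"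
  assumes "words.subspace C" "C \<subseteq> word_space n"
  shows "dual_code n (dual_code n C) = C"
proof -
  let ?D = "dual_code n C"
  have D: "words.subspace ?D" "?D \<subseteq> word_space n" by (rule subspace_dual_code) (auto simp: dual_code_def)
  have sub: "C \<subseteq> dual_code n ?D"
    using assms(2) by (auto simp: dual_code_def mult.commute)
  have fin: "finite (dual_code n ?D)" by (rule finite_code[of _ n]) (auto simp: dual_code_def)
  have "card ?D * card C = card ?D * card (dual_code n ?D)"
    using card_dual_code[OF assms] card_dual_code[OF D] by (simp add: mult.commute)
  moreover have "card ?D \<noteq> 0"
    using card_dual_code[OF assms] by (metis mult_0_right power_not_zero zero_less_card_finite less_irrefl)
  ultimately have "card C = card (dual_code n ?D)" by simp
  then show ?thesis using card_subset_eq[OF fin sub] by simp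
qed

lemma subspace_image:
  fixes \<rho> :: "(nat \<Rightarrow> 'a::field) \<Rightarrow> nat \<Rightarrow> 'a"
  assumes C: "words.subspace C" and add: "\<And>u v. \<rho> (u + v) = \<rho> u + \<rho> v"
    and scale: "\<And>c u. \<rho> (word_scale c u) = word_scale c (\<rho> u)"
  shows "words.subspace (\<rho> ` C)"
  unfolding words.subspace_def
proof (intro conjI ballI allI)
  have "\<rho> 0 = 0" using add[of 0 0] by simp
  then show "0 \<in> \<rho> ` C" using words.subspace_0[OF C] by (rule image_eqI[OF sym])
  fix x y assume "x \<in> \<rho> ` C" "y \<in> \<rho> ` C"
  then obtain u v where uv: "x = \<rho> u" "y = \<rho> v" "u \<in> C" "v \<in> C" by blast
  have "x + y = \<rho> (u + v)" by (simp add: uv add)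
  then show "x + y \<in> \<rho> ` C" using words.subspace_add[OF C uv(3,4)] by (rule image_eqI)
next
  fix c x assume "x \<in> \<rho> ` C"
  then obtain u where u: "x = \<rho> u" "u \<in> C" by blast
  have "word_scale c x = \<rho> (word_scale c u)" by (simp add: u scale)
  then show "word_scale c x \<in> \<rho> ` C" using words.subspace_scale[OF C u(2)] by (rule image_eqI)
qed

text \<open>A nonzero word on \<open>J\<close> that annihilates the restriction of \<open>C\<close>
  to \<open>J\<close> would be a dual word of weight at most \<open>card J\<close>. So the
  annihilator is trivial, the restriction is all of \<open>supp_space J\<close>, and its kernel has
  the stated size.\<close>

lemma card_vanishing_independent:
  fixes C :: "(nat \<Rightarrow> 'a::{field,finite}) set"
  assumes C: "words.subspace C" "C \<subseteq> word_space n" and J: "J \<subseteq> {..<n}"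
    and dual: "\<And>y. y \<in> dual_code n C \<Longrightarrow> y \<noteq> 0 \<Longrightarrow> card J < hamming_weight y"
  shows "card C = CARD('a) ^ card J * card (vanishing C J)"
proof -
  have fin: "finite C" using C(2) by (rule finite_code)
  have finJ: "finite J" using J finite_subset by blast
  define \<rho> where "\<rho> x = (\<lambda>i. if i \<in> J then x i else (0::'a))" for x
  have sub: "words.subspace (\<rho> ` C)"
    by (rule subspace_image[OF C(1)]) (auto simp: \<rho>_def word_scale_def fun_eq_iff)
  have "{y \<in> supp_space J. \<forall>x\<in>\<rho> ` C. (\<Sum>i\<in>J. x i * y i) = 0} \<subseteq> {0}"
  proof
    fix y assume y: "y \<in> {y \<in> supp_space J. \<forall>x\<in>\<rho> ` C. (\<Sum>i\<in>J. x i * y i) = 0}"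
    then have yJ: "y i = 0" if "i \<notin> J" for i using that by (auto simp: supp_space_def)
    have "(\<Sum>i<n. x i * y i) = 0" if "x \<in> C" for x
    proof -
      have "(\<Sum>i<n. x i * y i) = (\<Sum>i\<in>J. x i * y i)"
        using J yJ by (intro sum.mono_neutral_right) auto
      also have "\<dots> = (\<Sum>i\<in>J. \<rho> x i * y i)" by (intro sum.cong) (auto simp: \<rho>_def)
      also have "\<dots> = 0" using y that by blast
      finally show ?thesis .
    qed
    moreover have "y i = 0" if "n \<le> i" for i using J that by (intro yJ) auto
    ultimately have "y \<in> dual_code n C" by (simp add: dual_code_def word_space_def)
    moreover have "hamming_weight y \<le> card J"
      unfolding hamming_weight_def using finJ yJ by (intro card_mono) auto
    ultimately show "y \<in> {0}" using dual[of y] by auto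
  qed
  moreover have "0 \<in> {y \<in> supp_space J. \<forall>x\<in>\<rho> ` C. (\<Sum>i\<in>J. x i * y i) = 0}"
    by (simp add: supp_space_def)
  ultimately have one: "{y \<in> supp_space J. \<forall>x\<in>\<rho> ` C. (\<Sum>i\<in>J. x i * y i) = 0} = {0}" by blast
  have "\<rho> ` C \<subseteq> supp_space J" by (auto simp: \<rho>_def supp_space_def)
  from card_annihilator[OF finJ sub this] have "card (\<rho> ` C) = CARD('a) ^ card J"
    unfolding one by simp
  then show ?thesis using card_le_vanishing(2)[OF C(1) fin finJ] by (simp add: \<rho>_def)
qed

text \<open>\<open>big\<close> provides a word \<open>c'\<close> that is not a multiple of
  \<open>c\<close>. The weights of \<open>c\<close> and of the q words \<open>c' + t c\<close> are
  added position by position; the latter are nonzero and are bounded below by \<open>d\<close>,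
  while the weight of \<open>c\<close> is kept.\<close>

lemma pencil_weights:
  fixes V :: "(nat \<Rightarrow> 'a::{field,finite}) set"
  assumes V: "words.subspace V" "V \<subseteq> word_space n" and Z: "Z \<subseteq> {..<n}"
    and van: "\<And>x i. x \<in> V \<Longrightarrow> i \<in> Z \<Longrightarrow> x i = 0"
    and d: "\<And>x. x \<in> V \<Longrightarrow> x \<noteq> 0 \<Longrightarrow> d \<le> hamming_weight x"
    and c: "c \<in> V" and big: "CARD('a) < card V"
  shows "hamming_weight c + CARD('a) * d \<le> CARD('a) * (n - card Z)"
proof -
  let ?q = "CARD('a)"
  have "\<not> V \<subseteq> range (\<lambda>t. word_scale t c)"
  proof
    assume "V \<subseteq> range (\<lambda>t. word_scale t c)"
    then have "card V \<le> card (range (\<lambda>t. word_scale t c))" by (intro card_mono) auto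
    also have "\<dots> \<le> ?q" by (rule card_image_le) simp
    finally show False using big by simp
  qed
  then obtain c' where c': "c' \<in> V" "c' \<notin> range (\<lambda>t. word_scale t c)" by blast
  define w where "w t = c' + word_scale t c" for t
  have wV: "w t \<in> V" for t
    unfolding w_def using c c' V(1) words.subspace_add words.subspace_scale by blast
  have w0: "w t \<noteq> 0" for t
  proof
    assume "w t = 0"
    then have "c' = word_scale (- t) c" by (simp add: w_def eq_neg_iff_add_eq_0)
    then show False using c'(2) by blast
  qed
  define N where "N = {..<n} - Z"
  have finN: "finite N" by (simp add: N_def)
  have cardN: "card N = n - card Z"
    using Z by (simp add: N_def card_Diff_subset finite_subset)
  have wt: "hamming_weight x = (\<Sum>i\<in>N. if x i \<noteq> 0 then 1 else 0)" if "x \<in> V" for x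
  proof -
    have "{i. x i \<noteq> 0} = {i \<in> N. x i \<noteq> 0}"
      using that V(2) van[OF that] by (auto simp: N_def word_space_def not_less[symmetric])
    then show ?thesis using finN by (simp add: hamming_weight_def sum.If_cases Int_def)
  qed
  have "hamming_weight c + ?q * d = hamming_weight c + (\<Sum>t\<in>(UNIV :: 'a set). d)" by simp
  also have "\<dots> \<le> hamming_weight c + (\<Sum>t\<in>(UNIV :: 'a set). hamming_weight (w t))"
    by (intro add_left_mono sum_mono d wV w0)
  also have "\<dots> = (\<Sum>i\<in>N. if c i \<noteq> 0 then 1 else 0) + (\<Sum>t\<in>UNIV. \<Sum>i\<in>N. if w t i \<noteq> 0 then 1 else 0)"
    by (simp add: wt c wV)
  also have "\<dots> = (\<Sum>i\<in>N. (if c i \<noteq> 0 then 1 else 0) + (\<Sum>t\<in>UNIV. if w t i \<noteq> 0 then 1 else 0))"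
    by (simp add: sum.distrib sum.swap[of _ N])
  also have "\<dots> \<le> (\<Sum>i\<in>N. ?q)"
  proof (rule sum_mono)
    fix i
    have *: "(\<Sum>t\<in>UNIV. if w t i \<noteq> 0 then 1 else 0) = card {t. w t i \<noteq> 0}"
      by (simp add: sum.If_cases)
    \<comment> \<open>Where \<open>c\<close> vanishes it contributes nothing; elsewhere some
      \<open>t\<close> makes \<open>w t\<close> vanish. So at most q of the q + 1 words are nonzero
      at \<open>i\<close>.\<close>
    show "(if c i \<noteq> 0 then 1 else 0) + (\<Sum>t\<in>UNIV. if w t i \<noteq> 0 then 1 else 0) \<le> ?q"
    proof (cases "c i = 0")
      case True then show ?thesis unfolding * by (simp add: card_mono)
    next
      case False
      then have "w (- c' i / c i) i = 0" by (simp add: w_def word_scale_def)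
      then have "{t. w t i \<noteq> 0} \<subset> UNIV" by blast
      then have "card {t. w t i \<noteq> 0} < ?q" by (intro psubset_card_mono) auto
      then show ?thesis unfolding * using False by simp
    qed
  qed
  finally show ?thesis using cardN by (simp add: mult.commute)
qed

section \<open>Bounds for codes\<close>

lemma power_card_vanishing_ge:
  fixes C :: "(nat \<Rightarrow> 'a::{field,finite}) set"
  assumes "words.subspace C" "finite C" "card C = CARD('a) ^ k" "finite J" "card J + m = k"
  shows "CARD('a) ^ m \<le> card (vanishing C J)"
proof -
  have "CARD('a) ^ card J * CARD('a) ^ m \<le> CARD('a) ^ card J * card (vanishing C J)"
    using card_le_vanishing(1)[OF assms(1,2,4)] assms(3,5) by (simp flip: power_add)
  then show ?thesis by simp
qed

lemma CARD_less_square: "CARD('a::{field,finite}) < CARD('a) ^ 2"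
  using CARD_field_ge_2[where 'a = 'a] by (simp add: power2_eq_square)

text \<open>The bound on its weight gives \<open>c\<close> at least k - 2 zeros. Prescribing k - 2
  of them leaves at least q^2 words, and \<open>pencil_weights\<close> applies with d + s + 1
  remaining positions.\<close>

lemma weight_le_of_defect:
  fixes C :: "(nat \<Rightarrow> 'a::{field,finite}) set"
  assumes code: "linear_code n k d C" and "n + 1 = k + s + d" "2 \<le> k"
    and c: "c \<in> C" "hamming_weight c \<le> d + s + 1"
  shows "hamming_weight c \<le> CARD('a) * (s + 1)"
proof -
  note D = linear_codeD[OF code]
  have "hamming_weight c + card {i \<in> {..<n}. c i = 0} = n" using hamming_weight_eq c(1) D(1) by blast
  then have "k - 2 \<le> card {i \<in> {..<n}. c i = 0}" using assms by simp
  then obtain Z where Z: "Z \<subseteq> {i \<in> {..<n}. c i = 0}" "card Z = k - 2" "finite Z"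
    by (rule obtain_subset_with_card_n)
  have "CARD('a) ^ 2 \<le> card (vanishing C Z)"
    using D(2-4) Z(2,3) assms(3) by (intro power_card_vanishing_ge[of C k]) simp_all
  then have "CARD('a) < card (vanishing C Z)" using CARD_less_square[where 'a = 'a] by simp
  then have "hamming_weight c + CARD('a) * d \<le> CARD('a) * (n - card Z)"
    using D(1) Z(1) c(1) linear_code_weight_ge[OF code]
    by (intro pencil_weights[OF subspace_vanishing[OF D(2)]]) (auto simp: vanishing_def)
  also have "n - card Z = d + (s + 1)" using assms(2,3) Z(2) by simp
  finally show ?thesis by (simp add: add_mult_distrib2)
qed

text \<open>The support of \<open>y\<close> is enlarged to a set \<open>Z\<close> of k - 1
  positions. Because of the relation \<open>y\<close>, vanishing on \<open>Z\<close> amounts to at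
  most k - 2 conditions, so q^2 words remain on only d + s further positions, and (q + 1) d \<le> q
  (d + s).\<close>

lemma distance_le_of_dual_word:
  fixes C :: "(nat \<Rightarrow> 'a::{field,finite}) set"
  assumes code: "linear_code n k d C" and n: "n + 1 = k + s + d" "k \<le> n"
    and y: "y \<in> dual_code n C" "y \<noteq> 0" "hamming_weight y \<le> k - 1"
  shows "d \<le> CARD('a) * s"
proof -
  note D = linear_codeD[OF code]
  define Y where "Y = {i. y i \<noteq> 0}"
  have Yn: "Y \<subseteq> {..<n}" using y(1) by (auto simp: Y_def dual_code_def word_space_def not_less[symmetric])
  then have finY: "finite Y" using finite_subset by blast
  have cardY: "card Y \<le> k - 1" using y(3) by (simp add: hamming_weight_def Y_def)
  obtain i\<^sub>0 where i\<^sub>0: "y i\<^sub>0 \<noteq> 0" using y(2) by (auto simp: fun_eq_iff)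
  then have iY: "i\<^sub>0 \<in> Y" by (simp add: Y_def)
  then have "card Y \<noteq> 0" using finY by auto
  then have k: "2 \<le> k" using cardY by simp
  have "k - 1 - card Y \<le> card ({..<n} - Y)" using Yn finY n(2) by (simp add: card_Diff_subset)
  then obtain X where X: "X \<subseteq> {..<n} - Y" "card X = k - 1 - card Y" "finite X"
    by (rule obtain_subset_with_card_n)
  define Z where "Z = Y \<union> X"
  have Zn: "Z \<subseteq> {..<n}" "finite Z" using Yn X finY by (auto simp: Z_def)
  have "card Z = card Y + card X" unfolding Z_def using X finY by (intro card_Un_disjoint) auto
  then have cardZ: "card Z = k - 1" using X(2) cardY by simp
  have iZ: "i\<^sub>0 \<in> Z" using iY by (simp add: Z_def)
  \<comment> \<open>The relation given by \<open>y\<close> expresses the entry at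
    \<open>i\<^sub>0\<close> through the other entries on \<open>Z\<close>.\<close>
  have "vanishing C (Z - {i\<^sub>0}) \<subseteq> vanishing C Z"
  proof
    fix x assume x: "x \<in> vanishing C (Z - {i\<^sub>0})"
    then have "0 = (\<Sum>i<n. x i * y i)" using y(1) by (simp add: vanishing_def dual_code_def)
    also have "\<dots> = (\<Sum>i\<in>{i\<^sub>0}. x i * y i)"
      using x Yn iY by (intro sum.mono_neutral_right) (auto simp: vanishing_def Z_def Y_def)
    finally have "x i\<^sub>0 = 0" using i\<^sub>0 by simp
    then show "x \<in> vanishing C Z" using x by (auto simp: vanishing_def)
  qed
  then have "card (vanishing C (Z - {i\<^sub>0})) \<le> card (vanishing C Z)"
    using D(3) by (intro card_mono) (auto simp: vanishing_def)
  moreover have "CARD('a) ^ 2 \<le> card (vanishing C (Z - {i\<^sub>0}))"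
    using D(2-4) Zn cardZ iZ k by (intro power_card_vanishing_ge[of C k]) simp_all
  ultimately have big: "CARD('a) ^ 2 \<le> card (vanishing C Z)" by simp
  have "\<not> vanishing C Z \<subseteq> {0}"
  proof
    assume "vanishing C Z \<subseteq> {0}"
    then have "card (vanishing C Z) \<le> card {0 :: nat \<Rightarrow> 'a}" by (intro card_mono) auto
    then show False
      using big CARD_less_square[where 'a = 'a] CARD_field_ge_2[where 'a = 'a] by simp
  qed
  then obtain c where c: "c \<in> vanishing C Z" "c \<noteq> 0" by blast
  have "CARD('a) < card (vanishing C Z)" using big CARD_less_square[where 'a = 'a] by simp
  then have "hamming_weight c + CARD('a) * d \<le> CARD('a) * (n - card Z)"
    using D(1) Zn(1) c(1) linear_code_weight_ge[OF code]
    by (intro pencil_weights[OF subspace_vanishing[OF D(2)]]) (auto simp: vanishing_def)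
  moreover have "n - card Z = d + s" using n cardZ k by simp
  moreover have "d \<le> hamming_weight c" using linear_code_weight_ge[OF code] c by (auto simp: vanishing_def)
  ultimately show ?thesis by (simp add: add_mult_distrib2)
qed

lemma card_vanishing_eq:
  fixes C :: "(nat \<Rightarrow> 'a::{field,finite}) set"
  assumes code: "linear_code n k d C"
    and dual: "\<And>y. y \<in> dual_code n C \<Longrightarrow> y \<noteq> 0 \<Longrightarrow> k \<le> hamming_weight y"
    and J: "J \<subseteq> {..<n}" "card J + m = k" "0 < m"
  shows "card (vanishing C J) = CARD('a) ^ m"
proof -
  note D = linear_codeD[OF code]
  have "card C = CARD('a) ^ card J * card (vanishing C J)"
    using D J dual by (intro card_vanishing_independent) force+
  then have "CARD('a) ^ card J * CARD('a) ^ m = CARD('a) ^ card J * card (vanishing C J)"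
    using D(4) J(2) by (simp flip: power_add)
  then show ?thesis by simp
qed

text \<open>The zero set \<open>Z\<close> of a word \<open>c\<close> of minimum weight has n - d = k
  + s - 1 positions. A word vanishing at k - 1 of them vanishes on all of \<open>Z\<close>, so a
  nonzero restriction to \<open>Z\<close> has at most k - 2 zeros, hence weight at least s + 1: the
  Singleton value in dimension k - 1.\<close>

lemma mds_on_zeros:
  fixes C :: "(nat \<Rightarrow> 'a::{field,finite}) set"
  assumes code: "linear_code n k d C" and nd: "nondegenerate n C"
    and n: "n + 1 = k + s + d" "1 \<le> s" "2 \<le> k"
    and dual: "\<And>y. y \<in> dual_code n C \<Longrightarrow> y \<noteq> 0 \<Longrightarrow> k \<le> hamming_weight y"
  shows "enat (k + s - 1) \<le> max_mds_length TYPE('a) (k - 1)"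
proof -
  note D = linear_codeD[OF code]
  let ?q = "CARD('a)"
  let ?m = "k + s - 1"
  obtain c where c: "c \<in> C" "c \<noteq> 0" "hamming_weight c = d" using linear_code_ex_min_weight[OF code] .
  define Z where "Z = {i \<in> {..<n}. c i = 0}"
  have "hamming_weight c + card Z = n" unfolding Z_def using hamming_weight_eq c(1) D(1) by blast
  then have cardZ: "card Z = ?m" using c(3) n by simp
  have Zn: "Z \<subseteq> {..<n}" and finZ: "finite Z" by (auto simp: Z_def)
  have vZ: "card (vanishing C Z) \<ge> ?q"
  proof -
    have "inj (\<lambda>t. word_scale t c)"
    proof (rule injI)
      fix t u assume "word_scale t c = word_scale u c"
      then show "t = u" using c(2) words.scale_cancel_right by blast
    qed
    then have "?q = card (range (\<lambda>t. word_scale t c))" by (simp add: card_image)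
    also have "\<dots> \<le> card (vanishing C Z)"
      using D(3) words.subspace_scale[OF D(2) c(1)]
      by (intro card_mono) (auto simp: vanishing_def Z_def word_scale_def)
    finally show ?thesis .
  qed
  \<comment> \<open>Any k - 1 zeros leave exactly q words, and the multiples of \<open>c\<close>
    already supply q words vanishing on \<open>Z\<close>.\<close>
  have vJ: "vanishing C J = vanishing C Z" if J: "J \<subseteq> Z" "card J = k - 1" for J
  proof -
    have "card (vanishing C J) = ?q ^ 1"
      using J Zn n(3) by (intro card_vanishing_eq[OF code dual]) auto
    moreover have "vanishing C Z \<subseteq> vanishing C J" using J(1) by (auto simp: vanishing_def)
    moreover have "finite (vanishing C J)" using D(3) by (simp add: vanishing_def)
    ultimately show ?thesis using vZ by (intro card_seteq[symmetric]) simp_all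
  qed
  have "k - 1 \<le> card Z" "k - 2 \<le> card Z" using cardZ by simp_all
  obtain J where J: "J \<subseteq> Z" "card J = k - 1"
    by (rule obtain_subset_with_card_n[OF \<open>k - 1 \<le> card Z\<close>])
  have card_vZ: "card (vanishing C Z) = ?q"
    using vJ[OF J] card_vanishing_eq[OF code dual, of J 1] J Zn n(3) by simp
  \<comment> \<open>Numbering the positions in \<open>Z\<close> turns the restriction into a code of
    length k + s - 1.\<close>
  obtain h where h: "bij_betw h {..<?m} Z"
    using ex_bij_betw_nat_finite[OF finZ] cardZ by (auto simp: atLeast0LessThan)
  have hZ: "h i \<in> Z" if "i < ?m" for i using h that by (auto simp: bij_betw_def)
  define \<rho> where "\<rho> x = (\<lambda>i. if i < ?m then x (h i) else (0::'a))" for x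
  define C' where "C' = \<rho> ` C"
  have sub: "words.subspace C'"
    unfolding C'_def by (rule subspace_image[OF D(2)]) (auto simp: \<rho>_def word_scale_def fun_eq_iff)
  have Cw: "C' \<subseteq> word_space ?m" by (auto simp: C'_def \<rho>_def word_space_def)
  have \<rho>0: "\<rho> x = 0 \<longleftrightarrow> (\<forall>i\<in>Z. x i = 0)" for x
  proof -
    have "\<rho> x = 0 \<longleftrightarrow> (\<forall>i<?m. x (h i) = 0)" by (auto simp: \<rho>_def fun_eq_iff)
    also have "\<dots> \<longleftrightarrow> (\<forall>i\<in>h ` {..<?m}. x i = 0)" by auto
    also have "h ` {..<?m} = Z" using h by (simp add: bij_betw_def)
    finally show ?thesis .
  qed
  have "card C = card C' * card {x \<in> C. \<rho> x = 0}"
    unfolding C'_def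
    by (intro card_additive_image D(3) words.subspace_diff[OF D(2)]) (auto simp: \<rho>_def)
  also have "{x \<in> C. \<rho> x = 0} = vanishing C Z" by (simp add: vanishing_def \<rho>0)
  finally have "card C' * ?q = ?q ^ (k - 1) * ?q"
    using card_vZ D(4) n(3) by (simp add: power_Suc2[symmetric] del: power_Suc)
  then have cardC': "card C' = ?q ^ (k - 1)" by simp
  have wt: "hamming_weight (\<rho> x) + card {i \<in> Z. x i = 0} = ?m" for x
  proof -
    have "\<rho> x \<in> word_space ?m" by (auto simp: \<rho>_def word_space_def)
    then have "hamming_weight (\<rho> x) + card {i \<in> {..<?m}. \<rho> x i = 0} = ?m" by (rule hamming_weight_eq)
    moreover have "card {i \<in> {..<?m}. \<rho> x i = 0} = card {i \<in> Z. x i = 0}"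
    proof (rule bij_betw_same_card[of h])
      have "inj_on h {i \<in> {..<?m}. \<rho> x i = 0}" using h by (auto simp: bij_betw_def inj_on_def)
      moreover have "h ` {i \<in> {..<?m}. \<rho> x i = 0} = {i \<in> Z. x i = 0}"
        using h by (auto simp: bij_betw_def \<rho>_def)
      ultimately show "bij_betw h {i \<in> {..<?m}. \<rho> x i = 0} {i \<in> Z. x i = 0}"
        by (simp add: bij_betw_def)
    qed
    ultimately show ?thesis by simp
  qed
  have ge: "s + 1 \<le> hamming_weight y" if "y \<in> C'" "y \<noteq> 0" for y
  proof (rule ccontr)
    assume "\<not> s + 1 \<le> hamming_weight y"
    obtain x where x: "x \<in> C" "y = \<rho> x" using \<open>y \<in> C'\<close> by (auto simp: C'_def)
    then have "k - 1 \<le> card {i \<in> Z. x i = 0}" using wt[of x] \<open>\<not> s + 1 \<le> hamming_weight y\<close> by simp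
    then obtain K where K: "K \<subseteq> {i \<in> Z. x i = 0}" "card K = k - 1" "finite K"
      by (rule obtain_subset_with_card_n)
    have "x \<in> vanishing C K" using x K by (auto simp: vanishing_def)
    also have "vanishing C K = vanishing C Z" using K by (intro vJ) auto
    finally have "\<rho> x = 0" by (simp add: vanishing_def \<rho>0)
    then show False using x \<open>y \<noteq> 0\<close> by simp
  qed
  \<comment> \<open>Distance s + 1 is attained: k - 2 zeros in \<open>Z\<close> leave q^2 words,
    more than the q words that vanish on \<open>Z\<close>.\<close>
  obtain K where K: "K \<subseteq> Z" "card K = k - 2"
    by (rule obtain_subset_with_card_n[OF \<open>k - 2 \<le> card Z\<close>])
  have "card (vanishing C K) = ?q ^ 2"
    using K Zn n(3) by (intro card_vanishing_eq[OF code dual]) auto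
  then have "\<not> vanishing C K \<subseteq> vanishing C Z"
    using card_mono[of "vanishing C Z" "vanishing C K"] card_vZ CARD_less_square[where 'a = 'a] D(3)
    by (auto simp: vanishing_def)
  then obtain x where x: "x \<in> C" "\<forall>i\<in>K. x i = 0" "\<rho> x \<noteq> 0" by (auto simp: vanishing_def \<rho>0)
  have "card K \<le> card {i \<in> Z. x i = 0}" using K x finZ by (intro card_mono) auto
  then have "hamming_weight (\<rho> x) \<le> s + 1" using wt[of x] K(2) n(3) by simp
  then have "linear_code ?m (k - 1) (s + 1) C'"
    using x n(3) by (intro linear_codeI[OF Cw sub cardC' _ ge, of "\<rho> x"]) (auto simp: C'_def)
  then have "almost_mds 0 ?m (k - 1) (s + 1) C'"
    using n by (simp add: almost_mds_def singleton_defect_def)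
  moreover have "nondegenerate ?m C'"
    unfolding nondegenerate_def
  proof (intro allI impI)
    fix i assume i: "i < ?m"
    then have "h i < n" using hZ Zn by blast
    then obtain x where "x \<in> C" "x (h i) \<noteq> 0" using nd by (auto simp: nondegenerate_def)
    then show "\<exists>y\<in>C'. y i \<noteq> 0" using i by (auto simp: C'_def \<rho>_def)
  qed
  ultimately show ?thesis unfolding max_mds_length_def by (intro Sup_upper) blast
qed

section \<open>Three-dimensional subcodes as point sets in the plane\<close>

definition dot3 :: "'a::field vec3 \<Rightarrow> 'a vec3 \<Rightarrow> 'a" where
  "dot3 a b = c1 a * c1 b + c2 a * c2 b + c3 a * c3 b"

definition cross3 :: "'a::field vec3 \<Rightarrow> 'a vec3 \<Rightarrow> 'a vec3" where
  "cross3 a b = Vec3 (c2 a * c3 b - c3 a * c2 b) (c3 a * c1 b - c1 a * c3 b) (c1 a * c2 b - c2 a * c1 b)"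

lemma det3_eq_dot3_cross3: "det3 a b p = dot3 (cross3 a b) p"
  by (simp add: det3_def dot3_def cross3_def algebra_simps)

text \<open>The Binet-Cauchy identity for the scalar product of two cross products.\<close>

lemma det3_cross3: "det3 a b (cross3 v w) = dot3 v a * dot3 w b - dot3 w a * dot3 v b"
  by (simp add: det3_def dot3_def cross3_def algebra_simps)

text \<open>The words of a basis are the rows of a generator matrix and \<open>g i\<close> is its
  column at position \<open>i\<close>; the words of \<open>W\<close> are the linear forms evaluated
  at the columns.\<close>

lemma subspace_card_cube_coordinates:
  fixes W :: "(nat \<Rightarrow> 'a::{field,finite}) set"
  assumes W: "words.subspace W" "finite W" "card W = CARD('a) ^ 3"
  shows "\<exists>g :: nat \<Rightarrow> 'a vec3. W = range (\<lambda>v i. dot3 v (g i)) \<and>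
    (\<forall>v. (\<lambda>i. dot3 v (g i)) = 0 \<longrightarrow> v = 0)"
proof -
  have "CARD('a) ^ words.dim W = CARD('a) ^ 3" using card_subspace[OF W(1,2)] W(3) by simp
  then have dim: "words.dim W = 3" using CARD_field_ge_2[where 'a = 'a] by (simp add: power_inject_exp)
  obtain B where B: "B \<subseteq> W" "words.independent B" "W \<subseteq> words.span B" "card B = words.dim W"
    using words.basis_exists by metis
  have span: "W = words.span B" using B W(1) words.span_minimal by blast
  obtain x y z where xyz: "B = {x, y, z}" "x \<noteq> y" "y \<noteq> z" "x \<noteq> z"
    using B(4) dim by (auto simp: card_3_iff)
  define g where "g i = Vec3 (x i) (y i) (z i)" for i
  have L: "(\<Sum>b\<in>B. word_scale (u b) b) = (\<lambda>i. dot3 (Vec3 (u x) (u y) (u z)) (g i))" for u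
    using xyz by (auto simp: word_scale_def g_def dot3_def fun_eq_iff)
  show ?thesis
  proof (intro exI[of _ g] conjI allI impI equalityI subsetI)
    fix w assume "w \<in> W"
    then obtain u where "w = (\<Sum>b\<in>B. word_scale (u b) b)"
      unfolding span using words.span_finite[of B] xyz by auto
    then show "w \<in> range (\<lambda>v i. dot3 v (g i))" using L by auto
  next
    fix w assume "w \<in> range (\<lambda>v i. dot3 v (g i))"
    then obtain v where v: "w = (\<lambda>i. dot3 v (g i))" by auto
    have "w = word_scale (c1 v) x + word_scale (c2 v) y + word_scale (c3 v) z"
      by (auto simp: v dot3_def g_def word_scale_def fun_eq_iff)
    then show "w \<in> W" using B(1) xyz W(1) by (simp add: words.subspace_add words.subspace_scale)
  next
    fix v assume v: "(\<lambda>i. dot3 v (g i)) = 0"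
    define u where "u b = (if b = x then c1 v else if b = y then c2 v else c3 v)" for b
    have "Vec3 (u x) (u y) (u z) = v" using xyz by (simp add: u_def)
    then have "(\<Sum>b\<in>B. word_scale (u b) b) = 0" using L[of u] v by simp
    then have "u b = 0" if "b \<in> B" for b
      using words.independentD[OF B(2) _ subset_refl, of u b] that xyz(1) by simp
    then have "u x = 0" "u y = 0" "u z = 0" using xyz(1) by auto
    then show "v = 0" using \<open>Vec3 (u x) (u y) (u z) = v\<close> by (simp add: zero_vec3_def)
  qed
qed

text \<open>Shortening at k - 3 positions leaves a three-dimensional code whose columns at the other
  d + 3 positions form an arc. Then d + 3 \<le> 2 q + 1 by \<open>arc3_card_le\<close>.\<close>

lemma near_mds_distance_le:
  fixes C :: "(nat \<Rightarrow> 'a::{field,finite}) set"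
  assumes code: "linear_code n k d C" and n: "n = k + d" "3 \<le> k"
    and dual: "\<And>y. y \<in> dual_code n C \<Longrightarrow> y \<noteq> 0 \<Longrightarrow> k \<le> hamming_weight y"
    and q: "CARD('a) > 3"
  shows "d + 2 \<le> 2 * CARD('a)"
proof -
  note D = linear_codeD[OF code]
  let ?q = "CARD('a)"
  define J where "J = {..<k - 3}"
  have J: "J \<subseteq> {..<n}" "card J = k - 3" "finite J" using n by (auto simp: J_def)
  define W where "W = vanishing C J"
  have W: "words.subspace W" "finite W" "card W = ?q ^ 3"
    using subspace_vanishing[OF D(2)] D(3) card_vanishing_eq[OF code dual J(1), of 3] J(2) n(2)
    by (auto simp: W_def vanishing_def)
  obtain g :: "nat \<Rightarrow> 'a vec3" where g: "W = range (\<lambda>v i. dot3 v (g i))"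
    and g0: "\<And>v. (\<lambda>i. dot3 v (g i)) = 0 \<Longrightarrow> v = 0"
    using subspace_card_cube_coordinates[OF W] by blast
  define I where "I = {..<n} - J"
  have I: "finite I" "card I = d + 3" using J n by (auto simp: I_def card_Diff_subset)
  \<comment> \<open>Otherwise a zero at \<open>i\<close> would force one at \<open>j\<close>,
    although k - 2 zeros leave q^2 words and k - 1 zeros only q.\<close>
  have sep: "\<exists>v. dot3 v (g i) = 0 \<and> dot3 v (g j) \<noteq> 0" if ij: "i \<in> I" "j \<in> I" "i \<noteq> j" for i j
  proof (rule ccontr)
    assume no: "\<not> ?thesis"
    have J1: "insert i J \<subseteq> {..<n}" "card (insert i J) = k - 2"
      and J2: "insert j (insert i J) \<subseteq> {..<n}" "card (insert j (insert i J)) = k - 1"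
      using ij J n(2) by (auto simp: I_def)
    have "vanishing C (insert i J) \<subseteq> vanishing C (insert j (insert i J))"
    proof
      fix w assume w: "w \<in> vanishing C (insert i J)"
      then have "w \<in> W" by (auto simp: W_def vanishing_def)
      then obtain v where v: "w = (\<lambda>i. dot3 v (g i))" using g by auto
      then have "dot3 v (g i) = 0" using w by (auto simp: vanishing_def)
      then have "w j = 0" using no v by auto
      then show "w \<in> vanishing C (insert j (insert i J))" using w by (auto simp: vanishing_def)
    qed
    then have "card (vanishing C (insert i J)) \<le> card (vanishing C (insert j (insert i J)))"
      using D(3) by (intro card_mono) (auto simp: vanishing_def)
    moreover have "card (vanishing C (insert i J)) = ?q ^ 2"
      using J1 n(2) by (intro card_vanishing_eq[OF code dual]) auto
    moreover have "card (vanishing C (insert j (insert i J))) = ?q ^ 1"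
      using J2 n(2) by (intro card_vanishing_eq[OF code dual]) auto
    ultimately show False using CARD_less_square[where 'a = 'a] by simp
  qed
  have ind: "indep (g i) (g j)" if ij: "i \<in> I" "j \<in> I" "i \<noteq> j" for i j
  proof -
    obtain v w where "dot3 v (g j) = 0" "dot3 v (g i) \<noteq> 0" "dot3 w (g i) = 0" "dot3 w (g j) \<noteq> 0"
      using sep[OF ij] sep[OF ij(2,1)] ij(3) by metis
    then have "det3 (g i) (g j) (cross3 v w) \<noteq> 0" by (simp add: det3_cross3)
    then show ?thesis by (auto simp: indep_def)
  qed
  have inj: "inj_on g I" by (rule inj_onI) (metis ind indep_irrefl)
  have "arc3 (g ` I)"
    unfolding arc3_def
  proof (intro conjI ballI impI)
    show "finite (g ` I)" using I by simp
    fix a b assume "a \<in> g ` I" "b \<in> g ` I" "a \<noteq> b"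
    then obtain i j where ij: "a = g i" "b = g j" "i \<in> I" "j \<in> I" "i \<noteq> j" by blast
    then show "indep a b" using ind by simp
    \<comment> \<open>The word whose zeros are the columns on the line \<open>a b\<close>. It has at
      most n - d = k zeros, and k - 3 of them lie in \<open>J\<close>.\<close>
    define w where "w = (\<lambda>p. dot3 (cross3 a b) (g p))"
    have wW: "w \<in> W" using g by (auto simp: w_def)
    have "w \<noteq> 0"
    proof
      assume "w = 0"
      then have "cross3 a b = 0" using g0 by (simp add: w_def)
      then have "det3 a b p = 0" for p by (simp add: det3_eq_dot3_cross3 dot3_def zero_vec3_def)
      then show False using \<open>indep a b\<close> by (simp add: indep_def)
    qed
    then have "d \<le> hamming_weight w" using linear_code_weight_ge[OF code] wW by (auto simp: W_def vanishing_def)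
    moreover have "hamming_weight w + card {p \<in> {..<n}. w p = 0} = n"
      using D(1) wW by (intro hamming_weight_eq) (auto simp: W_def vanishing_def)
    moreover have "card {p \<in> {..<n}. w p = 0} = card J + card {p \<in> I. w p = 0}"
    proof -
      have "{p \<in> {..<n}. w p = 0} = J \<union> {p \<in> I. w p = 0}"
        using wW J(1) by (auto simp: I_def W_def vanishing_def)
      then show ?thesis using J(3) I(1) by (simp add: I_def card_Un_disjoint disjoint_iff)
    qed
    ultimately have le: "card {p \<in> I. w p = 0} \<le> 3" using J(2) n by linarith
    have "line (g ` I) a b = g ` {p \<in> I. w p = 0}"
      by (auto simp: line_def w_def det3_eq_dot3_cross3)
    then show "card (line (g ` I) a b) \<le> 3"
      using card_image_le[of "{p \<in> I. w p = 0}" g] le I(1) by simp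
  qed
  then have "card (g ` I) \<le> 2 * ?q + 1" using arc3_card_le q by blast
  then show ?thesis using inj I(2) by (simp add: card_image)
qed

section \<open>Nondegeneracy in terms of dual weights\<close>

lemma nondegenerate_dual_weight:
  assumes "nondegenerate n C" "y \<in> dual_code n C" "y \<noteq> 0"
  shows "2 \<le> hamming_weight y"
proof (rule ccontr)
  assume "\<not> 2 \<le> hamming_weight y"
  obtain i where i: "y i \<noteq> 0" using assms(3) by (auto simp: fun_eq_iff)
  have sub: "{i. y i \<noteq> 0} \<subseteq> {..<n}"
    using assms(2) by (auto simp: dual_code_def word_space_def not_less[symmetric])
  then have fin: "finite {i. y i \<noteq> 0}" using finite_subset by blast
  have eq: "{i} = {i. y i \<noteq> 0}"
    using \<open>\<not> 2 \<le> hamming_weight y\<close> i fin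
    by (intro card_seteq) (auto simp: hamming_weight_def)
  have in_n: "i < n" using i sub by blast
  then obtain x where x: "x \<in> C" "x i \<noteq> 0" using assms(1) by (auto simp: nondegenerate_def)
  have "0 = (\<Sum>j<n. x j * y j)" using assms(2) x(1) by (simp add: dual_code_def)
  also have "\<dots> = (\<Sum>j\<in>{i}. x j * y j)"
    using in_n eq by (intro sum.mono_neutral_right) auto
  finally show False using x i by simp
qed

text \<open>At a position where all words vanish, the unit word would be a dual word of weight
  1.\<close>

lemma nondegenerate_of_dual_weight:
  assumes "\<And>y. y \<in> dual_code n C \<Longrightarrow> y \<noteq> 0 \<Longrightarrow> 2 \<le> hamming_weight y"
  shows "nondegenerate n C"
  unfolding nondegenerate_def
proof (intro allI impI, rule ccontr)
  fix i assume i: "i < n" and "\<not> (\<exists>x\<in>C. x i \<noteq> 0)"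
  then have 0: "x i = 0" if "x \<in> C" for x using that by blast
  define y where "y = (\<lambda>j. if j = i then 1 else (0::'a))"
  have "(\<Sum>j<n. x j * y j) = 0" if "x \<in> C" for x
    using 0[OF that] by (intro sum.neutral) (simp add: y_def)
  then have "y \<in> dual_code n C" using i by (auto simp: dual_code_def word_space_def y_def)
  moreover have "y \<noteq> 0" by (auto simp: y_def fun_eq_iff)
  ultimately have "2 \<le> hamming_weight y" by (rule assms)
  moreover have "{j. y j \<noteq> 0} = {i}" by (auto simp: y_def)
  ultimately show False by (simp add: hamming_weight_def)
qed

theorem mainTheorem1:
  fixes C :: "(nat \<Rightarrow> 'a::{field,finite}) set"
    and n k d k' d' s t q :: nat
  assumes "q = CARD('a)"
    and "nondegenerate n C"
    and "almost_mds s n k d C"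
    and "almost_mds t n k' d' (dual_code n C)"
    and "k' = n - k"
    and "d > 1"
    and "s \<ge> 1"
    and "t \<ge> 1"
  shows
    "((t > 1 \<longrightarrow> n \<le> s * (q + 1) + k - 1) \<and>
      (s > 1 \<longrightarrow> k \<le> t * (q + 1) - 1)) \<and>
     (t = 1 \<longrightarrow>
      (\<forall>\<alpha>\<le>s + 1. (\<exists>c\<in>C. hamming_weight c = d + s + 1 - \<alpha>) \<longrightarrow>
        n \<le> q * (s + 1) + k - 2 + \<alpha>)) \<and>
     (s = 1 \<longrightarrow>
      n \<le> (t + 1) * (q + 1) + k' - 2 \<and> k \<le> (t + 1) * (q + 1) - 2) \<and>
     (s = 1 \<and> t = 1 \<and> q > 3 \<and> k \<ge> 3 \<longrightarrow>
      n \<le> 2 * q + k - 2 \<and> (n > k + 2 \<longrightarrow> k \<le> 2 * q - 2)) \<and>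
     (t = 1 \<longrightarrow>
      enat (k + s - 1) \<le> max_mds_length TYPE('a) (k - 1) \<and>
      enat n \<le> max_mds_length TYPE('a) (k - 1) + enat (k' - s + 1)) \<and>
     (s = 1 \<longrightarrow>
      enat (k' + t - 1) \<le> max_mds_length TYPE('a) (k' - 1) \<and>
      enat n \<le> max_mds_length TYPE('a) (k' - 1) + enat (k - t + 1)) \<and>
     (s = 1 \<and> t = 1 \<longrightarrow>
      enat k \<le> max_mds_length TYPE('a) (k - 1) \<and>
      enat k' \<le> max_mds_length TYPE('a) (k' - 1)) \<and>
     k \<le> (t + 1) * (q + 1) - 2"
proof -
  let ?D = "dual_code n C"
  have code: "linear_code n k d C" and dcode: "linear_code n k' d' ?D"
    and n: "n + 1 = k + s + d" and n': "n + 1 = k' + t + d'"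
    using assms(3,4) by (auto simp: almost_mds_def singleton_defect_def)
  \<comment> \<open>Since \<open>k'\<close> is positive, the truncated difference n - k is
    exact.\<close>
  have kk: "n = k + k'" using linear_codeD(5)[OF dcode] assms(5) by simp
  have kd: "k' + 1 = s + d" "k + 1 = t + d'" using n n' kk by simp_all
  have dd: "dual_code n ?D = C" using dual_dual_code linear_codeD(1,2)[OF code] by blast
  obtain y where y: "y \<in> ?D" "y \<noteq> 0" "hamming_weight y = d'" using linear_code_ex_min_weight[OF dcode] .
  obtain c where c: "c \<in> C" "c \<noteq> 0" "hamming_weight c = d" using linear_code_ex_min_weight[OF code] .
  have d': "2 \<le> d'" using nondegenerate_dual_weight[OF assms(2) y(1,2)] y(3) by simp
  have k: "t + 1 \<le> k" "s + 1 \<le> k'" using kd d' assms(6) by simp_all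
  \<comment> \<open>The condition d > 1 on the bidual, which is \<open>C\<close>, makes the dual
    code nondegenerate.\<close>
  have nd': "nondegenerate n ?D"
  proof (rule nondegenerate_of_dual_weight)
    fix x assume "x \<in> dual_code n ?D" "x \<noteq> 0"
    then show "2 \<le> hamming_weight x" using linear_code_weight_ge[OF code, of x] dd assms(6) by simp
  qed
  have dual: "d' \<le> hamming_weight x" if "x \<in> ?D" "x \<noteq> 0" for x using linear_code_weight_ge[OF dcode that] .
  have dual': "d \<le> hamming_weight x" if "x \<in> dual_code n ?D" "x \<noteq> 0" for x
    using linear_code_weight_ge[OF code] that dd by simp
  \<comment> \<open>For t > 1 a dual word of minimum weight has weight d' \<le> k - 1. The next
    claim is the same with \<open>C\<close> and its dual interchanged.\<close>
  have 1: "n \<le> s * (q + 1) + k - 1" if "t > 1"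
  proof -
    have "d \<le> q * s" unfolding assms(1)
      using kd kk that y by (intro distance_le_of_dual_word[OF code n _ y(1,2)]) simp_all
    then show ?thesis using n k by (simp add: algebra_simps)
  qed
  have 2: "k \<le> t * (q + 1) - 1" if "s > 1"
  proof -
    have "d' \<le> q * t" unfolding assms(1)
      using kd kk that c dd by (intro distance_le_of_dual_word[OF dcode n', of c]) simp_all
    then show ?thesis using kd by (simp add: algebra_simps)
  qed
  have 3: "n \<le> q * (s + 1) + k - 2 + \<alpha>"
    if "\<alpha> \<le> s + 1" "x \<in> C" "hamming_weight x = d + s + 1 - \<alpha>" for \<alpha> x
  proof -
    have "hamming_weight x \<le> q * (s + 1)" unfolding assms(1)
      using k that assms(8) by (intro weight_le_of_defect[OF code n]) simp_all
    then show ?thesis using that n k assms(8) by linarith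
  qed
  \<comment> \<open>The weight bound is applied to a dual word of minimum weight, and k = t + d' -
    1.\<close>
  have 4: "k \<le> (t + 1) * (q + 1) - 2"
  proof -
    have "d' \<le> q * (t + 1)" unfolding assms(1)
      using weight_le_of_defect[OF dcode n' _ y(1)] y(3) k assms(7) by simp
    then show ?thesis using kd by (simp add: algebra_simps)
  qed
  \<comment> \<open>t = 1 means d' = k, so every nonzero dual word has weight at least k.\<close>
  have 5: "enat (k + s - 1) \<le> max_mds_length TYPE('a) (k - 1)" if "t = 1"
  proof (rule mds_on_zeros[OF code assms(2) n assms(7)])
    show "k \<le> hamming_weight x" if "x \<in> ?D" "x \<noteq> 0" for x
      using dual[OF that] kd(2) \<open>t = 1\<close> by simp
  qed (use k assms(8) in simp)
  have 6: "enat (k' + t - 1) \<le> max_mds_length TYPE('a) (k' - 1)" if "s = 1"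
  proof (rule mds_on_zeros[OF dcode nd' n' assms(8)])
    show "k' \<le> hamming_weight x" if "x \<in> dual_code n ?D" "x \<noteq> 0" for x
      using dual'[OF that] kd(1) \<open>s = 1\<close> by simp
  qed (use k assms(7) in simp)
  have length_le: "enat n \<le> max_mds_length TYPE('a) (k - 1) + enat (k' - s + 1)" if "t = 1"
  proof -
    have "enat n = enat (k + s - 1) + enat (k' - s + 1)" using kk k by simp
    also have "\<dots> \<le> max_mds_length TYPE('a) (k - 1) + enat (k' - s + 1)"
      by (rule add_right_mono[OF 5[OF that]])
    finally show ?thesis .
  qed
  have length_le_dual: "enat n \<le> max_mds_length TYPE('a) (k' - 1) + enat (k - t + 1)" if "s = 1"
  proof -
    have "enat n = enat (k' + t - 1) + enat (k - t + 1)" using kk k by simp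
    also have "\<dots> \<le> max_mds_length TYPE('a) (k' - 1) + enat (k - t + 1)"
      by (rule add_right_mono[OF 6[OF that]])
    finally show ?thesis .
  qed
  have 7: "n \<le> 2 * q + k - 2 \<and> (n > k + 2 \<longrightarrow> k \<le> 2 * q - 2)" if "s = 1" "t = 1" "q > 3" "k \<ge> 3"
  proof (intro conjI impI)
    have "d + 2 \<le> 2 * q" unfolding assms(1)
    proof (rule near_mds_distance_le[OF code])
      show "k \<le> hamming_weight x" if "x \<in> ?D" "x \<noteq> 0" for x
        using dual[OF that] kd(2) \<open>t = 1\<close> by simp
    qed (use n that assms(1) in simp_all)
    then show "n \<le> 2 * q + k - 2" using n that(1) by simp
    \<comment> \<open>This is k' \<ge> 3, the condition for applying the bound to the dual
      code.\<close>
    assume "n > k + 2"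
    have "d' + 2 \<le> 2 * q" unfolding assms(1)
    proof (rule near_mds_distance_le[OF dcode])
      show "k' \<le> hamming_weight x" if "x \<in> dual_code n ?D" "x \<noteq> 0" for x
        using dual'[OF that] kd(1) \<open>s = 1\<close> by simp
    qed (use n' kk \<open>n > k + 2\<close> that assms(1) in simp_all)
    then show "k \<le> 2 * q - 2" using kd(2) that(2) by simp
  qed
  \<comment> \<open>The bound on \<open>k\<close> becomes one on \<open>n\<close> through n = k +
    k'.\<close>
  have "n \<le> (t + 1) * (q + 1) + k' - 2" using 4 kk k by linarith
  moreover have "enat k \<le> max_mds_length TYPE('a) (k - 1)" "enat k' \<le> max_mds_length TYPE('a) (k' - 1)"
    if "s = 1" "t = 1" using 5 6 that by simp_all
  ultimately show ?thesis using 1 2 3 4 5 6 length_le length_le_dual 7 by blast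
qed

end
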